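(* Given $s\in(0,1)$ and $F\in C^3(\mathbb{R})$, let $u:\mathbb{R}^n\to\mathbb{R}$ be a bounded solution of $$(-\Delta)^su=F'(u)\quad\text{in }\mathbb{R}^n.$$ Assume that $u$ is increasing in $x_n$. Then, for each bounded domain $\Omega\subset\mathbb{R}^n$, $u$ is a minimizer of $$\mathcal{E}_{s,F}(w)=\frac{c_{n,s}}{4}\iint_{Q(\Omega)}\frac{|w(x)-w(y)|^2}{|x-y|^{n+2s}}\,dx\,dy-\int_\Omega F(w(x))\,dx$$ among continuous functions $w:\mathbb{R}^n\to\mathbb{R}$ satisfying $$\lim_{\tau\to-\infty}u(x',\tau)\le w(x',x_n)\le\lim_{\tau\to+\infty}u(x',\tau)\quad\text{for all }(x',x_n)\in\mathbb{R}^{n-1}\times\mathbb{R}$$ and such that $w\equiv u$ in $\Omega^c$.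
   Context: Points are written $x=(x',x_n)\in\mathbb{R}^{n-1}\times\mathbb{R}$; $\Omega^c=\mathbb{R}^n\setminus\Omega$; $Q(\Omega):=(\mathbb{R}^n\times\mathbb{R}^n)\setminus(\Omega^c\times\Omega^c)$. The fractional Laplacian is $(-\Delta)^su(x)=c_{n,s}\,\mathrm{P.V.}\int_{\mathbb{R}^n}\frac{u(x)-u(y)}{|x-y|^{n+2s}}\,dy$, where $c_{n,s}$ is a positive normalizing constant (the same one as in $\mathcal{E}_{s,F}$). "Increasing" means strictly increasing. The hypothesis $F\in C^3$ is made so that bounded solutions $u$ are of class $C^2$. "Minimizer" means $\mathcal{E}_{s,F}(u)\le\mathcal{E}_{s,F}(w)$ for all such $w$, where $\mathcal{E}_{s,F}(w)$ may be $+\infty$. *)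

theory Defs
  imports "HOL-Analysis.Analysis"
begin

definition C_class :: "nat \<Rightarrow> (real \<Rightarrow> real) \<Rightarrow> bool" where
  "C_class k f \<longleftrightarrow>
     (\<forall>j<k. \<forall>x. (deriv ^^ j) f field_differentiable at x) \<and>
     continuous_on UNIV ((deriv ^^ k) f)"

(* R^n is real^'n with n = CARD('n) >= 1.  The index type carries no order, so the
   distinguished coordinate x_n is an arbitrary index k, and (x', tau) is the point
   obtained from x by replacing its k-th coordinate with tau. *)
definition set_coord :: "'n \<Rightarrow> real ^ 'n::finite \<Rightarrow> real \<Rightarrow> real ^ 'n" where
  "set_coord k x \<tau> = (\<chi> i. if i = k then \<tau> else x $ i)"

(* The normalizing constant c = c_{n,s} is a parameter here and in the energy below.
   The principal value excises balls centred at x.  Integrability is required because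
   the Bochner integral of a non-integrable function is 0 by convention; it is automatic
   for bounded measurable u. *)
definition has_frac_laplacian ::
  "real \<Rightarrow> real \<Rightarrow> (real ^ 'n::finite \<Rightarrow> real) \<Rightarrow> real \<Rightarrow> real ^ 'n \<Rightarrow> bool" where
  "has_frac_laplacian c s u l x \<longleftrightarrow>
     (\<forall>\<epsilon>>0. set_integrable lborel {y. norm (x - y) > \<epsilon>}
        (\<lambda>y. (u x - u y) / norm (x - y) powr (real CARD('n) + 2 * s))) \<and>
     ((\<lambda>\<epsilon>. c * (LINT y:{y. norm (x - y) > \<epsilon>}|lborel.
        (u x - u y) / norm (x - y) powr (real CARD('n) + 2 * s))) \<longlongrightarrow> l) (at_right 0)"

definition Q_region :: "'a set \<Rightarrow> ('a \<times> 'a) set" where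
  "Q_region \<Omega> = UNIV - (- \<Omega>) \<times> (- \<Omega>)"

(* The quadratic part may be infinite.  The potential part is a real number whenever
   F o w is integrable on \<Omega>, e.g. for bounded continuous w and bounded open \<Omega>. *)
definition energy ::
  "real \<Rightarrow> real \<Rightarrow> (real \<Rightarrow> real) \<Rightarrow> (real ^ 'n::finite) set \<Rightarrow> (real ^ 'n \<Rightarrow> real) \<Rightarrow> ereal" where
  "energy c s F \<Omega> w =
     ereal (c / 4) * enn2ereal (\<integral>\<^sup>+p\<in>Q_region \<Omega>.
        ennreal (\<bar>w (fst p) - w (snd p)\<bar>\<^sup>2 /
                 norm (fst p - snd p) powr (real CARD('n) + 2 * s)) \<partial>(lborel \<Otimes>\<^sub>M lborel))
     - ereal (LINT x:\<Omega>|lborel. F (w x))"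

definition admissible ::
  "'n \<Rightarrow> (real ^ 'n::finite \<Rightarrow> real) \<Rightarrow> (real ^ 'n) set \<Rightarrow> (real ^ 'n \<Rightarrow> real) set" where
  "admissible k u \<Omega> = {w. continuous_on UNIV w \<and>
     (\<forall>x. Lim at_bot (\<lambda>\<tau>. u (set_coord k x \<tau>)) \<le> w x \<and>
          w x \<le> Lim at_top (\<lambda>\<tau>. u (set_coord k x \<tau>))) \<and>
     (\<forall>x. x \<notin> \<Omega> \<longrightarrow> w x = u x)}"

definition minimizer_on :: "'f set \<Rightarrow> ('f \<Rightarrow> ereal) \<Rightarrow> 'f \<Rightarrow> bool" where
  "minimizer_on A E u \<longleftrightarrow> u \<in> A \<and> (\<forall>w\<in>A. E u \<le> E w)"

end

theory Submission imports Defs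
begin

text \<open>
  The translates $u(\cdot + t e)$ in the direction $e$ of monotonicity are ordered solutions, and a
  competitor $w$ can be moved to $u$ by sliding them, without increasing the energy. Write $p = n + 2s$,
  $f = F'$, and $L_\epsilon$ for the operator whose kernel $|z|^{-p}$ is cut off for
  $|z| \<le> \epsilon$.
  
  Suppose that $v \<le> w$ off $\Omega$ and raise $w$ to $w' = \max(w, v)$. Since the square is
  convex, the truncated Dirichlet part grows by at most $4 \int (w' - w) L_\epsilon w'$, and
  $L_\epsilon w' \<le> L_\epsilon v$ wherever $w' > w$, because $w'$ touches $v$ from above there. If
  $v$ is a subsolution up to an error, and close enough to $w$ that $F(w') - F(w)$ is nearly
  $f(v)(w' - w)$, then in the limit $\epsilon \rightarrow 0$ the energy increases by at most
  $\kappa \int_\Omega (w' - w)$ with a small $\kappa$ (dirichlet_increment,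
  energy_max_subsolution_le). A sequence of such steps through slowly varying functions $v$ has
  increments that telescope, so the total error stays small however many steps are taken.
  
  The limit $\epsilon \rightarrow 0$ requires a bound from above for $L_\epsilon v$ that is uniform in
  $\epsilon$, which the pointwise equation for a continuous $u$ does not supply directly. The functions $v$ are
  therefore translates of the sup-convolution of $u$, slightly lowered. A sup-convolution is
  semiconvex, which gives the uniform bound (trunc_lap_le_semiconvex). At each point it is touched
  from below by a translate of $u$, which makes it a subsolution up to a small error
  (sup_conv_touch, trunc_lap_leaf_le).
  
  The sliding starts at the translate by $-T$. As $w$ is at least the limit of $u$ along $-e$, the
  initial step, from $w$ to its maximum with that translate, costs at most a constant times
  $\int_\Omega (u(x - Te) - w(x))^+ dx$, which tends to $0$ as $T \rightarrow \infty$
  (near_max_energy_le). Removing the regularization by Fatou's lemma shows that $\max(w, u)$ has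
  at most the energy of $w$ (max_solution_energy_le). The same statement for $-u$ and $-e$ handles
  minima, and $\min(\max(w, u), u) = u$.
\<close>

section \<open>The singular kernel and its truncations\<close>

lemma term_le_suminf_ennreal: "f j \<le> (\<Sum>i. f i)" for f :: "nat \<Rightarrow> ennreal"
  using sum_le_suminf[of f "{j}"] by simp

text \<open>
  This is the Levy condition, and the two bounds on the exponent are what the two ends need:
  $p > n$ at infinity, $p < n + 2$ at the origin. Comparing with constants on the dyadic balls of
  radii $2^{j+1}$ and $2^{-j}$ turns the two halves into geometric series of ratios $2^{n-p}$ and
  $2^{p-n-2}$.
\<close>
lemma singular_kernel_mass:
  fixes p :: real
  assumes "real DIM('a::euclidean_space) < p" "p < real DIM('a) + 2"
  shows "integrable lborel (\<lambda>z::'a. min 1 ((norm z)\<^sup>2) / norm z powr p)"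
proof (rule integrableI_bounded)
  show "(\<lambda>z::'a. min 1 ((norm z)\<^sup>2) / norm z powr p) \<in> borel_measurable lborel"
    by measurable
  define d where "d = real DIM('a)"
  define a where "a = (2::real) powr (d - p)"
  define b where "b = (2::real) powr (p - d - 2)"
  define V where "V = unit_ball_vol d"
  have ab: "0 < a" "a < 1" "0 < b" "b < 1" and V: "V \<ge> 0"
    using assms unfolding a_def b_def d_def V_def
    by (auto simp: powr_less_one)
  let ?out = "\<lambda>(j::nat) (z::'a). ennreal (2 powr (- real j * p)) * indicator (cball 0 (2 powr (real j + 1))) z"
  let ?inn = "\<lambda>(j::nat) (z::'a). ennreal (2 powr ((real j + 1) * p - 2 * real j)) * indicator (cball 0 (2 powr (- real j))) z"
  have bound: "ennreal (norm (min 1 ((norm z)\<^sup>2) / norm z powr p)) \<le> (\<Sum>j. ?out j z) + (\<Sum>j. ?inn j z)" for z :: 'a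
  proof (cases "z = 0")
    case True then show ?thesis by simp
  next
    case z: False
    then have nz: "norm z > 0" by simp
    show ?thesis
    proof (cases "norm z \<ge> 1")
      case True
      define j where "j = nat \<lfloor>log 2 (norm z)\<rfloor>"
      have lg: "log 2 (norm z) \<ge> 0" using True nz by (simp add: zero_le_log_cancel_iff)
      have j1: "real j \<le> log 2 (norm z)" "log 2 (norm z) \<le> real j + 1"
        unfolding j_def using lg by linarith+
      have c1: "2 powr (real j) \<le> norm z" and c2: "norm z \<le> 2 powr (real j + 1)"
        using j1 nz by (simp_all add: le_log_iff log_le_iff)
      have p0: "p \<ge> 0" using assms(1) by linarith
      have "min 1 ((norm z)\<^sup>2) / norm z powr p \<le> 1 / norm z powr p"
        by (intro divide_right_mono) auto
      also have "\<dots> = norm z powr (-p)" by (simp add: powr_minus divide_simps)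
      also have "\<dots> \<le> (2 powr (real j)) powr (-p)"
        using c1 p0 by (intro powr_mono2') auto
      also have "\<dots> = 2 powr (- real j * p)" by (simp add: powr_powr)
      finally have "ennreal (norm (min 1 ((norm z)\<^sup>2) / norm z powr p)) \<le> ?out j z"
        using c2 by (simp add: ennreal_leI)
      also have "\<dots> \<le> (\<Sum>j. ?out j z)"
        by (rule term_le_suminf_ennreal)
      also have "\<dots> \<le> (\<Sum>j. ?out j z) + (\<Sum>j. ?inn j z)" by simp
      finally show ?thesis .
    next
      case False
      define j where "j = nat \<lfloor>- log 2 (norm z)\<rfloor>"
      have lg: "- log 2 (norm z) \<ge> 0" using False nz by (simp add: log_le_zero_cancel_iff)
      have j1: "real j \<le> - log 2 (norm z)" "- log 2 (norm z) \<le> real j + 1"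
        unfolding j_def using lg by linarith+
      have "log 2 (norm z) \<le> - real j" "- (real j + 1) \<le> log 2 (norm z)" using j1 by linarith+
      then have c2: "norm z \<le> 2 powr (- real j)" and c1: "2 powr (-(real j + 1)) \<le> norm z"
        using nz by (simp_all only: le_log_iff log_le_iff)
      have p0: "p \<ge> 0" using assms(1) by linarith
      have "min 1 ((norm z)\<^sup>2) / norm z powr p \<le> (norm z)\<^sup>2 * norm z powr (-p)"
        by (simp add: powr_minus divide_simps)
      also have "\<dots> \<le> (2 powr (- real j))\<^sup>2 * (2 powr (-(real j + 1))) powr (-p)"
        using c1 c2 p0 nz by (intro mult_mono power_mono powr_mono2') auto
      also have "\<dots> = 2 powr ((real j + 1) * p - 2 * real j)"
        by (simp add: powr_powr powr_power powr_add[symmetric] algebra_simps)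
      finally have "ennreal (norm (min 1 ((norm z)\<^sup>2) / norm z powr p)) \<le> ?inn j z"
        using c2 by (simp add: ennreal_leI)
      also have "\<dots> \<le> (\<Sum>j. ?inn j z)"
        by (rule term_le_suminf_ennreal)
      also have "\<dots> \<le> (\<Sum>j. ?out j z) + (\<Sum>j. ?inn j z)" by simp
      finally show ?thesis .
    qed
  qed
  have out: "(\<integral>\<^sup>+z. ?out j z \<partial>lborel) = ennreal (V * 2 powr d * a ^ j)" for j
  proof -
    have "(\<integral>\<^sup>+z. ?out j z \<partial>lborel) = ennreal (2 powr (- real j * p)) * ennreal (V * (2 powr (real j + 1)) ^ DIM('a))"
      by (subst nn_integral_cmult_indicator) (simp_all add: emeasure_cball V_def d_def)
    also have "\<dots> = ennreal (2 powr (- real j * p) * (V * (2 powr (real j + 1)) ^ DIM('a)))"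
      using V by (simp add: ennreal_mult)
    also have "2 powr (- real j * p) * (V * (2 powr (real j + 1)) ^ DIM('a)) = V * 2 powr d * a ^ j"
      by (simp add: a_def d_def powr_power powr_add[symmetric] algebra_simps)
    finally show ?thesis .
  qed
  have inn: "(\<integral>\<^sup>+z. ?inn j z \<partial>lborel) = ennreal (V * 2 powr p * b ^ j)" for j
  proof -
    have "(\<integral>\<^sup>+z. ?inn j z \<partial>lborel) = ennreal (2 powr ((real j + 1) * p - 2 * real j)) * ennreal (V * (2 powr (- real j)) ^ DIM('a))"
      by (subst nn_integral_cmult_indicator) (simp_all add: emeasure_cball V_def d_def)
    also have "\<dots> = ennreal (2 powr ((real j + 1) * p - 2 * real j) * (V * (2 powr (- real j)) ^ DIM('a)))"
      using V by (simp add: ennreal_mult)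
    also have "2 powr ((real j + 1) * p - 2 * real j) * (V * (2 powr (- real j)) ^ DIM('a)) = V * 2 powr p * b ^ j"
      by (simp add: b_def d_def powr_power powr_add[symmetric] algebra_simps)
    finally show ?thesis .
  qed
  have so: "summable (\<lambda>j. V * 2 powr d * a ^ j)" and si: "summable (\<lambda>j. V * 2 powr p * b ^ j)"
    using ab by (auto intro!: summable_mult summable_geometric)
  have "(\<integral>\<^sup>+z. ennreal (norm (min 1 ((norm z)\<^sup>2) / norm (z::'a) powr p)) \<partial>lborel)
      \<le> (\<integral>\<^sup>+z. (\<Sum>j. ?out j z) + (\<Sum>j. ?inn j z) \<partial>lborel)"
    by (intro nn_integral_mono bound)
  also have "\<dots> = (\<integral>\<^sup>+z. (\<Sum>j. ?out j z) \<partial>lborel) + (\<integral>\<^sup>+z. (\<Sum>j. ?inn j z) \<partial>lborel)"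
    by (rule nn_integral_add) (intro borel_measurable_suminf_order borel_measurable_times_ennreal borel_measurable_const borel_measurable_indicator, simp)+
  also have "\<dots> = (\<Sum>j. \<integral>\<^sup>+z. ?out j z \<partial>lborel) + (\<Sum>j. \<integral>\<^sup>+z. ?inn j z \<partial>lborel)"
    by (intro arg_cong2[where f = "(+)"] nn_integral_suminf) (intro borel_measurable_times_ennreal borel_measurable_const borel_measurable_indicator, simp)+
  also have "\<dots> = ennreal (\<Sum>j. V * 2 powr d * a ^ j) + ennreal (\<Sum>j. V * 2 powr p * b ^ j)"
    unfolding out inn using so si ab V by (intro arg_cong2[where f = "(+)"] suminf_ennreal2) simp_all
  also have "\<dots> < \<infinity>" by simp
  finally show "(\<integral>\<^sup>+z. ennreal (norm (min 1 ((norm z)\<^sup>2) / norm (z::'a) powr p)) \<partial>lborel) < \<infinity>" .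
qed

lemma lborel_reflect: "distr lborel borel (\<lambda>y. x - y) = (lborel :: 'a::euclidean_space measure)"
proof -
  have "(lborel :: 'a measure) = density (distr lborel borel (\<lambda>y. x + (-1) *\<^sub>R y)) (\<lambda>_. 1)"
    using lborel_affine[of "-1" x] by simp
  then show ?thesis by (simp add: density_1)
qed

text \<open>
  The case $\epsilon = 0$ is the full kernel: at $z = 0$ the strict inequality gives the value $0$,
  which is also the value of $1 / |z|^p$ there, because $0$ powr $p$ and $1/0$ are $0$.
\<close>
definition trunc_kernel :: "real \<Rightarrow> real \<Rightarrow> 'a::euclidean_space \<Rightarrow> real" where
  "trunc_kernel p \<epsilon> z = (if norm z > \<epsilon> then 1 / norm z powr p else 0)"

definition trunc_lap :: "real \<Rightarrow> real \<Rightarrow> ('a::euclidean_space \<Rightarrow> real) \<Rightarrow> 'a \<Rightarrow> real" where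
  "trunc_lap p \<epsilon> v x = (\<integral>y. (v x - v y) * trunc_kernel p \<epsilon> (x - y) \<partial>lborel)"

text \<open>
  The quadratic part of the energy without the factor $c/4$, kept as an extended nonnegative number
  because it may diverge when $\epsilon = 0$.
\<close>
definition dirichlet :: "real \<Rightarrow> real \<Rightarrow> 'a::euclidean_space set \<Rightarrow> ('a \<Rightarrow> real) \<Rightarrow> ennreal" where
  "dirichlet p \<epsilon> \<Omega> w = (\<integral>\<^sup>+q\<in>Q_region \<Omega>.
     ennreal (\<bar>w (fst q) - w (snd q)\<bar>\<^sup>2 * trunc_kernel p \<epsilon> (fst q - snd q)) \<partial>(lborel \<Otimes>\<^sub>M lborel))"

lemma trunc_kernel_measurable [measurable]: "trunc_kernel p \<epsilon> \<in> borel_measurable borel"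
  unfolding trunc_kernel_def[abs_def] by measurable

lemma trunc_kernel_nonneg [simp]: "trunc_kernel p \<epsilon> z \<ge> 0"
  by (simp add: trunc_kernel_def)

lemma trunc_kernel_minus: "trunc_kernel p \<epsilon> (x - y) = trunc_kernel p \<epsilon> (y - x)"
  by (simp add: trunc_kernel_def norm_minus_commute)

lemma trunc_kernel_uminus [simp]: "trunc_kernel p \<epsilon> (- z) = trunc_kernel p \<epsilon> z"
  by (simp add: trunc_kernel_def)

lemma trunc_kernel_antimono: "\<epsilon> \<le> \<epsilon>' \<Longrightarrow> trunc_kernel p \<epsilon>' z \<le> trunc_kernel p \<epsilon> z"
  by (simp add: trunc_kernel_def)

lemma trunc_kernel_integrable:
  assumes p: "real DIM('a::euclidean_space) < p" "p < real DIM('a) + 2" and \<epsilon>: "\<epsilon> > 0"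
  shows "integrable lborel (trunc_kernel p \<epsilon> :: 'a \<Rightarrow> real)"
proof (rule Bochner_Integration.integrable_bound)
  show "integrable lborel (\<lambda>z::'a. (1 / min 1 (\<epsilon>\<^sup>2)) * (min 1 ((norm z)\<^sup>2) / norm z powr p))"
    by (intro integrable_mult_right singular_kernel_mass p)
  show "AE z in lborel. norm (trunc_kernel p \<epsilon> (z::'a))
      \<le> norm ((1 / min 1 (\<epsilon>\<^sup>2)) * (min 1 ((norm z)\<^sup>2) / norm z powr p))"
  proof (rule AE_I2)
    fix z :: 'a
    show "norm (trunc_kernel p \<epsilon> z) \<le> norm ((1 / min 1 (\<epsilon>\<^sup>2)) * (min 1 ((norm z)\<^sup>2) / norm z powr p))"
    proof (cases "norm z > \<epsilon>")
      case True
      have "\<epsilon>\<^sup>2 \<le> (norm z)\<^sup>2" using True \<epsilon> by (intro power_mono) auto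
      then have "min 1 (\<epsilon>\<^sup>2) \<le> min 1 ((norm z)\<^sup>2)" by linarith
      then have "1 \<le> (1 / min 1 (\<epsilon>\<^sup>2)) * min 1 ((norm z)\<^sup>2)"
        using \<epsilon> by (simp add: le_divide_eq)
      then have "1 / norm z powr p \<le> ((1 / min 1 (\<epsilon>\<^sup>2)) * min 1 ((norm z)\<^sup>2)) / norm z powr p"
        by (intro divide_right_mono) auto
      then show ?thesis using True \<epsilon> by (simp add: trunc_kernel_def abs_mult)
    qed (simp add: trunc_kernel_def)
  qed
qed simp

lemma
  fixes \<phi> :: "'a::euclidean_space \<Rightarrow> real"
  assumes [measurable]: "\<phi> \<in> borel_measurable borel"
  shows integral_lborel_reflect: "(\<integral>y. \<phi> (x - y) \<partial>lborel) = (\<integral>y. \<phi> y \<partial>lborel)"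
    and integrable_lborel_reflect: "integrable lborel (\<lambda>y. \<phi> (x - y)) \<longleftrightarrow> integrable lborel \<phi>"
proof -
  have "(\<integral>y. \<phi> y \<partial>lborel) = (\<integral>y. \<phi> y \<partial>(distr lborel borel (\<lambda>y. x - y)))"
    by (simp add: lborel_reflect)
  also have "\<dots> = (\<integral>y. \<phi> (x - y) \<partial>lborel)"
    by (rule integral_distr) measurable
  finally show "(\<integral>y. \<phi> (x - y) \<partial>lborel) = (\<integral>y. \<phi> y \<partial>lborel)" ..
  have "integrable lborel \<phi> \<longleftrightarrow> integrable (distr lborel borel (\<lambda>y. x - y)) \<phi>"
    by (simp add: lborel_reflect)
  also have "\<dots> \<longleftrightarrow> integrable lborel (\<lambda>y. \<phi> (x - y))"
    by (rule integrable_distr_eq) measurable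
  finally show "integrable lborel (\<lambda>y. \<phi> (x - y)) \<longleftrightarrow> integrable lborel \<phi>" ..
qed

lemma bounded_mult_trunc_kernel_integrable:
  fixes \<phi> :: "'a::euclidean_space \<Rightarrow> real"
  assumes p: "real DIM('a) < p" "p < real DIM('a) + 2" and \<epsilon>: "\<epsilon> > 0"
    and [measurable]: "\<phi> \<in> borel_measurable borel" and B: "\<And>y. \<bar>\<phi> y\<bar> \<le> B"
  shows "integrable lborel (\<lambda>y. \<phi> y * trunc_kernel p \<epsilon> (x - y))"
proof (rule Bochner_Integration.integrable_bound)
  show "integrable lborel (\<lambda>y::'a. B * trunc_kernel p \<epsilon> (x - y))"
    using trunc_kernel_integrable[OF p \<epsilon>] by (intro integrable_mult_right) (simp add: integrable_lborel_reflect)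
  show "AE y in lborel. norm (\<phi> y * trunc_kernel p \<epsilon> (x - y)) \<le> norm (B * trunc_kernel p \<epsilon> (x - y))"
    using B by (intro AE_I2) (auto simp: abs_mult intro!: mult_right_mono order_trans[OF B])
qed measurable

lemma trunc_lap_measurable [measurable]:
  assumes [measurable]: "v \<in> borel_measurable borel"
  shows "trunc_lap p \<epsilon> v \<in> borel_measurable borel"
  unfolding trunc_lap_def[abs_def] by measurable

lemma Q_region_measurable [measurable]:
  "\<Omega> \<in> sets (borel :: 'a::topological_space measure) \<Longrightarrow> Q_region \<Omega> \<in> sets (borel \<Otimes>\<^sub>M borel)"
  using sets.top[of "borel \<Otimes>\<^sub>M borel :: ('a \<times> 'a) measure"] unfolding Q_region_def
  by (intro sets.Diff pair_measureI) (auto simp: space_pair_measure)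

text \<open>
  Up to constants, these two functions of a pair of points dominate every integrand of the
  truncated problem, since a pair in the interaction region has at least one point in $\Omega$.
\<close>
lemma indicator_mult_trunc_kernel_integrable:
  fixes \<Omega> :: "'a::euclidean_space set"
  assumes p: "real DIM('a) < p" "p < real DIM('a) + 2" and \<epsilon>: "\<epsilon> > 0"
    and [measurable]: "\<Omega> \<in> sets borel" and "bounded \<Omega>"
  shows "integrable (lborel \<Otimes>\<^sub>M lborel) (\<lambda>q. indicator \<Omega> (fst q) * trunc_kernel p \<epsilon> (fst q - snd q))" (is ?A)
    and "integrable (lborel \<Otimes>\<^sub>M lborel) (\<lambda>q. indicator \<Omega> (snd q) * trunc_kernel p \<epsilon> (fst q - snd q))" (is ?B)
proof -
  have \<Omega>: "integrable lborel (indicator \<Omega> :: 'a \<Rightarrow> real)"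
    using emeasure_bounded_finite[OF \<open>bounded \<Omega>\<close>] by (intro integrable_real_indicator) auto
  note K = trunc_kernel_integrable[OF p \<epsilon>]
  show ?A
  proof (rule lborel_pair.Fubini_integrable)
    show "integrable lborel (\<lambda>x. \<integral>y. norm (indicator \<Omega> (fst (x, y)) * trunc_kernel p \<epsilon> (fst (x, y) - snd (x, y))) \<partial>lborel)"
      using \<Omega> by (simp add: abs_mult integral_lborel_reflect)
    show "AE x in lborel. integrable lborel (\<lambda>y. indicator \<Omega> (fst (x, y)) * trunc_kernel p \<epsilon> (fst (x, y) - snd (x, y)) :: real)"
      using K by (intro AE_I2) (simp add: integrable_lborel_reflect)
  qed measurable
  from lborel_pair.integrable_product_swap[OF this] show ?B
    by (simp add: case_prod_beta' trunc_kernel_minus)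
qed

section \<open>Raising a competitor to the maximum with a subsolution\<close>

text \<open>
  With $a = w'(x) - w'(y)$ and $b = w(x) - w(y)$, convexity of the square gives
  $a^2 - b^2 \<le> 2 a (a - b)$, where $a - b = h(x) - h(y)$ for $h = w' - w$. As $h$ vanishes off
  $\Omega$, the right-hand side vanishes off the interaction region, so it may be integrated over all
  pairs; exchanging $x$ and $y$ then identifies the terms with $h(x)$ and with $h(y)$. The truncation
  makes all these integrals absolutely convergent.
\<close>
lemma dirichlet_increment:
  fixes w w' :: "'a::euclidean_space \<Rightarrow> real"
  assumes p: "real DIM('a) < p" "p < real DIM('a) + 2" and \<epsilon>: "\<epsilon> > 0"
    and \<Omega> [measurable]: "\<Omega> \<in> sets borel" and bd: "bounded \<Omega>"
    and [measurable]: "w \<in> borel_measurable borel" "w' \<in> borel_measurable borel"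
    and B: "\<And>x. \<bar>w x\<bar> \<le> B" "\<And>x. \<bar>w' x\<bar> \<le> B"
    and off: "\<And>x. x \<notin> \<Omega> \<Longrightarrow> w' x = w x"
  shows "dirichlet p \<epsilon> \<Omega> w < \<infinity>"
    and "enn2real (dirichlet p \<epsilon> \<Omega> w') \<le>
      enn2real (dirichlet p \<epsilon> \<Omega> w) + 4 * (\<integral>x. (w' x - w x) * trunc_lap p \<epsilon> w' x \<partial>lborel)"
    and "integrable lborel (\<lambda>x. (w' x - w x) * trunc_lap p \<epsilon> w' x)"
proof -
  define P where "P = (lborel \<Otimes>\<^sub>M lborel :: ('a \<times> 'a) measure)"
  define k where "k = (\<lambda>q::'a \<times> 'a. trunc_kernel p \<epsilon> (fst q - snd q))"
  define e where "e = (\<lambda>(w :: 'a \<Rightarrow> real) q. indicator (Q_region \<Omega>) q * ((w (fst q) - w (snd q))\<^sup>2 * k q))"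
  have sets_P [measurable_cong]: "sets P = sets (borel \<Otimes>\<^sub>M borel)"
    unfolding P_def by (intro sets_pair_measure_cong) simp_all
  have [measurable]: "k \<in> borel_measurable P"
    unfolding k_def by measurable
  note KA = indicator_mult_trunc_kernel_integrable(1)[OF p \<epsilon> \<Omega> bd, folded P_def]
  note KB = indicator_mult_trunc_kernel_integrable(2)[OF p \<epsilon> \<Omega> bd, folded P_def]
  have B0: "B \<ge> 0" using B(1)[of 0] by linarith
  have e_int: "integrable P (e f)"
    if [measurable]: "f \<in> borel_measurable borel" and f: "\<And>x. \<bar>f x\<bar> \<le> B" for f
  proof (rule Bochner_Integration.integrable_bound)
    show "integrable P (\<lambda>q. (2 * B)\<^sup>2 * (indicator \<Omega> (fst q) * k q + indicator \<Omega> (snd q) * k q))"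
      using KA KB unfolding k_def by (intro integrable_mult_right Bochner_Integration.integrable_add)
    show "e f \<in> borel_measurable P" unfolding e_def by measurable
    show "AE q in P. norm (e f q) \<le> norm ((2 * B)\<^sup>2 * (indicator \<Omega> (fst q) * k q + indicator \<Omega> (snd q) * k q))"
    proof (rule AE_I2)
      fix q :: "'a \<times> 'a"
      have k0: "k q \<ge> 0" by (simp add: k_def)
      have "\<bar>f (fst q) - f (snd q)\<bar> \<le> 2 * B" using f[of "fst q"] f[of "snd q"] by linarith
      then have "(f (fst q) - f (snd q))\<^sup>2 \<le> (2 * B)\<^sup>2"
        by (metis abs_ge_zero power2_abs power_mono)
      moreover have "indicator (Q_region \<Omega>) q \<le> (indicator \<Omega> (fst q) + indicator \<Omega> (snd q) :: real)"
        by (cases q) (auto simp: Q_region_def indicator_def)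
      ultimately have "e f q \<le> (indicator \<Omega> (fst q) + indicator \<Omega> (snd q)) * ((2 * B)\<^sup>2 * k q)"
        unfolding e_def using k0 by (intro mult_mono mult_right_mono) (auto simp: indicator_def)
      moreover have "e f q \<ge> 0" unfolding e_def using k0 by simp
      ultimately show "norm (e f q) \<le> norm ((2 * B)\<^sup>2 * (indicator \<Omega> (fst q) * k q + indicator \<Omega> (snd q) * k q))"
        by (simp add: algebra_simps)
    qed
  qed
  have D: "dirichlet p \<epsilon> \<Omega> f = ennreal (\<integral>q. e f q \<partial>P)"
    if "f \<in> borel_measurable borel" "\<And>x. \<bar>f x\<bar> \<le> B" for f
  proof -
    have "dirichlet p \<epsilon> \<Omega> f = (\<integral>\<^sup>+q. ennreal (e f q) \<partial>P)"
      unfolding dirichlet_def e_def P_def k_def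
      by (intro nn_integral_cong) (auto simp: indicator_def)
    also have "\<dots> = ennreal (\<integral>q. e f q \<partial>P)"
      using e_int[OF that] by (intro nn_integral_eq_integral) (auto simp: e_def k_def)
    finally show ?thesis .
  qed
  show "dirichlet p \<epsilon> \<Omega> w < \<infinity>" using D[of w] B by simp
  have nonneg: "(\<integral>q. e f q \<partial>P) \<ge> 0" for f
    by (intro Bochner_Integration.integral_nonneg) (auto simp: e_def k_def)
  define g where "g = (\<lambda>q. (w' (fst q) - w (fst q)) * ((w' (fst q) - w' (snd q)) * k q))"
  have g_int: "integrable P g"
  proof (rule Bochner_Integration.integrable_bound)
    show "integrable P (\<lambda>q. (2 * B) * (2 * B) * (indicator \<Omega> (fst q) * k q))"
      using KA unfolding k_def by (intro integrable_mult_right)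
    show "g \<in> borel_measurable P" unfolding g_def by measurable
    show "AE q in P. norm (g q) \<le> norm ((2 * B) * (2 * B) * (indicator \<Omega> (fst q) * k q))"
    proof (rule AE_I2)
      fix q :: "'a \<times> 'a"
      have k0: "k q \<ge> 0" by (simp add: k_def)
      have "\<bar>w' (fst q) - w (fst q)\<bar> \<le> 2 * B * indicator \<Omega> (fst q)"
        using off[of "fst q"] B(1)[of "fst q"] B(2)[of "fst q"] by (auto simp: indicator_def)
      moreover have "\<bar>w' (fst q) - w' (snd q)\<bar> \<le> 2 * B"
        using B(2)[of "fst q"] B(2)[of "snd q"] by linarith
      ultimately have "\<bar>w' (fst q) - w (fst q)\<bar> * (\<bar>w' (fst q) - w' (snd q)\<bar> * k q) \<le> (2 * B * indicator \<Omega> (fst q)) * ((2 * B) * k q)"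
        using k0 B0 by (intro mult_mono mult_right_mono) auto
      then show "norm (g q) \<le> norm ((2 * B) * (2 * B) * (indicator \<Omega> (fst q) * k q))"
        using k0 B0 by (simp add: g_def abs_mult mult_ac)
    qed
  qed
  let ?g' = "\<lambda>q. g (snd q, fst q)"
  have g'_int: "integrable P ?g'" and g'_eq: "(\<integral>q. ?g' q \<partial>P) = (\<integral>q. g q \<partial>P)"
    using lborel_pair.integrable_product_swap[of g] lborel_pair.integral_product_swap[of g] g_int
    unfolding P_def by (auto simp: case_prod_beta')
  have "(\<integral>q. e w' q \<partial>P) - (\<integral>q. e w q \<partial>P) = (\<integral>q. e w' q - e w q \<partial>P)"
    using B by (intro Bochner_Integration.integral_diff[symmetric] e_int) auto
  also have "\<dots> \<le> (\<integral>q. 2 * g q + 2 * ?g' q \<partial>P)"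
  proof (rule integral_mono)
    show "integrable P (\<lambda>q. e w' q - e w q)"
      using B by (intro Bochner_Integration.integrable_diff e_int) auto
    show "integrable P (\<lambda>q. 2 * g q + 2 * ?g' q)"
      using g_int g'_int by simp
    fix q :: "'a \<times> 'a"
    obtain x y :: 'a where q: "q = (x, y)" by (cases q)
    have k0: "k (x, y) \<ge> 0" and ks: "k (y, x) = k (x, y)" by (simp_all add: k_def trunc_kernel_minus)
    have eq: "2 * g q + 2 * ?g' q = (2 * (w' x - w' y) * ((w' x - w' y) - (w x - w y))) * k (x, y)"
      by (simp add: g_def q ks algebra_simps)
    show "e w' q - e w q \<le> 2 * g q + 2 * ?g' q"
    proof (cases "x \<in> \<Omega> \<or> y \<in> \<Omega>")
      case True
      have "(w' x - w' y)\<^sup>2 - (w x - w y)\<^sup>2 \<le> 2 * (w' x - w' y) * ((w' x - w' y) - (w x - w y))"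
        using zero_le_power2[of "(w' x - w' y) - (w x - w y)"] by (simp add: power2_eq_square algebra_simps)
      from mult_right_mono[OF this k0] show ?thesis
        unfolding eq using True by (auto simp: e_def q Q_region_def algebra_simps)
    next
      case False
      then show ?thesis unfolding eq using off[of x] off[of y] by (simp add: e_def q Q_region_def)
    qed
  qed
  also have "\<dots> = 4 * (\<integral>q. g q \<partial>P)"
    using g_int g'_int g'_eq by simp
  also have "(\<integral>q. g q \<partial>P) = (\<integral>x. (w' x - w x) * trunc_lap p \<epsilon> w' x \<partial>lborel)"
    using lborel_pair.integral_fst'[of g] g_int
    unfolding P_def g_def trunc_lap_def k_def by simp
  finally show "enn2real (dirichlet p \<epsilon> \<Omega> w') \<le>
      enn2real (dirichlet p \<epsilon> \<Omega> w) + 4 * (\<integral>x. (w' x - w x) * trunc_lap p \<epsilon> w' x \<partial>lborel)"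
    using D[of w] D[of w'] B nonneg by simp
  show "integrable lborel (\<lambda>x. (w' x - w x) * trunc_lap p \<epsilon> w' x)"
    using lborel_pair.integrable_fst'[of g] g_int
    unfolding P_def g_def trunc_lap_def k_def by simp
qed

text \<open>
  The energy as a real number. It is meaningful only when the Dirichlet part is finite, because
  enn2real sends infinity to $0$; the comparisons below therefore assume and conclude that finiteness.
\<close>
definition finite_energy :: "real \<Rightarrow> real \<Rightarrow> (real \<Rightarrow> real) \<Rightarrow> 'a::euclidean_space set \<Rightarrow> ('a \<Rightarrow> real) \<Rightarrow> real" where
  "finite_energy c p F \<Omega> w = c / 4 * enn2real (dirichlet p 0 \<Omega> w) - (LINT x:\<Omega>|lborel. F (w x))"

lemma dirichlet_antimono: "\<epsilon> \<le> \<epsilon>' \<Longrightarrow> dirichlet p \<epsilon>' \<Omega> w \<le> dirichlet p \<epsilon> \<Omega> w"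
  unfolding dirichlet_def
  by (intro nn_integral_mono mult_right_mono ennreal_leI mult_left_mono trunc_kernel_antimono) auto

text \<open>
  Fatou's lemma, with the truncation radius and the function varying together. The constant function
  with $\epsilon_i \rightarrow 0$ removes the truncation; $\epsilon_i = 0$ gives lower
  semicontinuity of the full Dirichlet part under pointwise convergence.
\<close>
lemma dirichlet_le_liminf:
  fixes w :: "nat \<Rightarrow> 'a::euclidean_space \<Rightarrow> real"
  assumes [measurable]: "\<Omega> \<in> sets borel" "\<And>i. w i \<in> borel_measurable borel"
    and lim: "\<And>x. (\<lambda>i. w i x) \<longlonglongrightarrow> f x" and e: "\<epsilon> \<longlonglongrightarrow> 0" "\<And>i. \<epsilon> i \<ge> 0"
  shows "dirichlet p 0 \<Omega> f \<le> liminf (\<lambda>i. dirichlet p (\<epsilon> i) \<Omega> (w i))"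
proof -
  have k: "(\<lambda>i. trunc_kernel p (\<epsilon> i) z) \<longlonglongrightarrow> trunc_kernel p 0 z" for z :: 'a
  proof (cases "z = 0")
    case True
    then have "trunc_kernel p (\<epsilon> i) z = 0" for i using e(2)[of i] by (simp add: trunc_kernel_def)
    then show ?thesis using True by (simp add: trunc_kernel_def)
  next
    case False
    then have "\<forall>\<^sub>F i in sequentially. \<epsilon> i < norm z"
      using order_tendstoD(2)[OF e(1)] by simp
    then have "\<forall>\<^sub>F i in sequentially. trunc_kernel p (\<epsilon> i) z = trunc_kernel p 0 z"
      using False by (auto simp: trunc_kernel_def elim: eventually_mono)
    then show ?thesis by (rule tendsto_eventually)
  qed
  let ?I = "\<lambda>i q. ennreal (\<bar>w i (fst q) - w i (snd q)\<bar>\<^sup>2 * trunc_kernel p (\<epsilon> i) (fst q - snd q)) * indicator (Q_region \<Omega>) q"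
  have "(\<lambda>i. ?I i q) \<longlonglongrightarrow> ennreal (\<bar>f (fst q) - f (snd q)\<bar>\<^sup>2 * trunc_kernel p 0 (fst q - snd q)) * indicator (Q_region \<Omega>) q" for q
    by (cases "q \<in> Q_region \<Omega>") (auto intro!: tendsto_ennrealI tendsto_intros lim k)
  then have "dirichlet p 0 \<Omega> f = (\<integral>\<^sup>+q. liminf (\<lambda>i. ?I i q) \<partial>(lborel \<Otimes>\<^sub>M lborel))"
    unfolding dirichlet_def by (intro nn_integral_cong) (metis (no_types, lifting) lim_imp_Liminf sequentially_bot)
  also have "\<dots> \<le> liminf (\<lambda>i. dirichlet p (\<epsilon> i) \<Omega> (w i))"
    unfolding dirichlet_def by (intro nn_integral_liminf) measurable
  finally show ?thesis .
qed

lemma bounded_set_integrable: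
  fixes f :: "'a::euclidean_space \<Rightarrow> real"
  assumes "\<Omega> \<in> sets borel" "bounded \<Omega>" "f \<in> borel_measurable borel" "\<And>x. x \<in> \<Omega> \<Longrightarrow> \<bar>f x\<bar> \<le> B"
  shows "set_integrable lborel \<Omega> f"
proof -
  have "integrable lborel (\<lambda>x. indicator \<Omega> x *\<^sub>R B)"
    using emeasure_bounded_finite[OF assms(2)] assms(1) by simp
  then show ?thesis unfolding set_integrable_def
    by (rule Bochner_Integration.integrable_bound) (use assms in \<open>auto simp: indicator_def intro: AE_I2 order_trans[OF _ abs_ge_self]\<close>)
qed

lemma continuous_bounded_on_bounded_range:
  fixes F :: "real \<Rightarrow> real"
  assumes "continuous_on UNIV F"
  obtains Q where "Q \<ge> 0" "\<And>r. \<bar>r\<bar> \<le> B \<Longrightarrow> \<bar>F r\<bar> \<le> Q"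
proof -
  have "compact (F ` {-B..B})"
    using assms by (intro compact_continuous_image) (auto intro: continuous_on_subset)
  then obtain Q where "\<forall>y\<in>F ` {-B..B}. norm y \<le> Q" using compact_imp_bounded bounded_iff by metis
  moreover have "F r \<in> F ` {-B..B}" if "\<bar>r\<bar> \<le> B" for r using that by (auto simp: abs_le_iff)
  ultimately have "\<bar>F r\<bar> \<le> max 0 Q" if "\<bar>r\<bar> \<le> B" for r
    using that by (metis max.coboundedI2 real_norm_def)
  then show ?thesis by (intro that[of "max 0 Q"]) auto
qed

text \<open>
  The basic comparison. Where $h = w' - w$ is positive, $w'$ equals $v$, and $w' \<ge> v$ everywhere,
  so the truncated operator of $w'$ is at most that of $v$ at such points. The increment of the
  truncated Dirichlet part is thus controlled by $\int h\, L_\epsilon v$, and the pointwise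
  subsolution property bounds the limit of $c\, h\, L_\epsilon v$ by
  $F(w') - F(w) + \kappa h$. The uniform upper bound $C$ is needed to pass to the limit
  under the integral. The subsolution property is stated with the difference quotient of
  $F$ between $w$ and $v$, so that one statement covers small steps, where $\kappa$ is small, and one
  large step, where it is not.
\<close>
lemma energy_max_subsolution_le:
  fixes w v :: "'a::euclidean_space \<Rightarrow> real"
  assumes p: "real DIM('a) < p" "p < real DIM('a) + 2" and c: "c > 0"
    and \<Omega> [measurable]: "\<Omega> \<in> sets borel" and bd: "bounded \<Omega>" and F: "continuous_on UNIV F"
    and w_meas [measurable]: "w \<in> borel_measurable borel" and [measurable]: "v \<in> borel_measurable borel"
    and B: "\<And>x. \<bar>w x\<bar> \<le> B" "\<And>x. \<bar>v x\<bar> \<le> B"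
    and off: "\<And>x. x \<notin> \<Omega> \<Longrightarrow> v x \<le> w x"
    and C: "\<And>\<epsilon> x. \<epsilon> > 0 \<Longrightarrow> x \<in> \<Omega> \<Longrightarrow> trunc_lap p \<epsilon> v x \<le> C"
    and sub: "\<And>x. x \<in> \<Omega> \<Longrightarrow> w x < v x \<Longrightarrow>
      \<forall>\<^sub>F \<epsilon> in at_right 0. (v x - w x) * (c * trunc_lap p \<epsilon> v x) \<le> F (v x) - F (w x) + \<kappa> * (v x - w x)"
    and fin: "dirichlet p 0 \<Omega> w < \<infinity>"
  defines "w' \<equiv> (\<lambda>x. max (w x) (v x))"
  shows "dirichlet p 0 \<Omega> w' < \<infinity>"
    and "finite_energy c p F \<Omega> w' \<le> finite_energy c p F \<Omega> w + \<kappa> * (LINT x:\<Omega>|lborel. w' x - w x)"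
proof -
  have w'_meas [measurable]: "w' \<in> borel_measurable borel" unfolding w'_def by measurable
  have B': "\<And>x. \<bar>w' x\<bar> \<le> B" using B unfolding w'_def by (simp add: max_def)
  have off': "\<And>x. x \<notin> \<Omega> \<Longrightarrow> w' x = w x" using off unfolding w'_def by (simp add: max_absorb1)
  have [measurable]: "F \<in> borel_measurable borel" using F by (rule borel_measurable_continuous_onI)
  have B0: "B \<ge> 0" using B(1)[of 0] by linarith
  obtain Q where Q: "Q \<ge> 0" "\<And>r. \<bar>r\<bar> \<le> B \<Longrightarrow> \<bar>F r\<bar> \<le> Q"
    using continuous_bounded_on_bounded_range[OF F] by metis
  define h where "h = (\<lambda>x. w' x - w x)"
  have h0: "h x \<ge> 0" for x by (simp add: h_def w'_def)
  have hB: "h x \<le> 2 * B" for x using B(1)[of x] B'[of x] unfolding h_def by linarith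
  have h_off: "x \<notin> \<Omega> \<Longrightarrow> h x = 0" for x using off' by (simp add: h_def)
  define q where "q = (\<lambda>x. F (w' x) - F (w x) + \<kappa> * h x)"
  have q_off: "x \<notin> \<Omega> \<Longrightarrow> q x = 0" for x using off' h_off by (simp add: q_def)
  have qB: "\<bar>q x\<bar> \<le> 2 * Q + \<bar>\<kappa>\<bar> * (2 * B)" for x
  proof -
    have "\<bar>\<kappa> * h x\<bar> \<le> \<bar>\<kappa>\<bar> * (2 * B)" using h0[of x] hB[of x] by (simp add: abs_mult mult_left_mono)
    then show ?thesis unfolding q_def using Q(2)[OF B'[of x]] Q(2)[OF B(1)[of x]] by linarith
  qed
  define e :: "nat \<Rightarrow> real" where "e = (\<lambda>i. inverse (real (Suc i)))"
  have e0: "e i > 0" for i by (simp add: e_def)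
  have e_lim: "e \<longlonglongrightarrow> 0" unfolding e_def by (rule LIMSEQ_inverse_real_of_nat)
  have e_at: "filterlim e (at_right 0) sequentially"
    unfolding filterlim_at using e_lim e0 by (auto intro!: always_eventually simp: less_imp_neq[OF e0, symmetric])
  \<comment> \<open>Only an upper bound is known for the operator. Taking the maximum with the expected limit
    supplies a lower bound, and makes dominated convergence applicable.\<close>
  define m where "m = (\<lambda>i x. max (h x * (c * trunc_lap p (e i) v x)) (q x))"
  have m_meas [measurable]: "m i \<in> borel_measurable borel" for i
    unfolding m_def h_def q_def by measurable
  define M where "M = 2 * B * (c * \<bar>C\<bar>) + (2 * Q + \<bar>\<kappa>\<bar> * (2 * B))"
  have mM: "norm (m i x) \<le> M * indicator \<Omega> x" for i x
  proof (cases "x \<in> \<Omega>")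
    case True
    have "c * trunc_lap p (e i) v x \<le> c * \<bar>C\<bar>" using C[OF e0 True, of i] c by simp
    then have "h x * (c * trunc_lap p (e i) v x) \<le> h x * (c * \<bar>C\<bar>)"
      using h0 by (rule mult_left_mono)
    also have "\<dots> \<le> 2 * B * (c * \<bar>C\<bar>)" using hB c by (intro mult_right_mono) auto
    finally have "h x * (c * trunc_lap p (e i) v x) \<le> 2 * B * (c * \<bar>C\<bar>)" .
    moreover have "2 * B * (c * \<bar>C\<bar>) \<ge> 0" using B0 c by simp
    ultimately have "m i x \<le> M" "- M \<le> m i x" using qB[of x] unfolding m_def M_def by linarith+
    then show ?thesis using True by simp
  next
    case False then show ?thesis by (simp add: m_def q_off h_off)
  qed
  have m_lim: "(\<lambda>i. m i x) \<longlonglongrightarrow> q x" for x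
  proof (cases "x \<in> \<Omega> \<and> w x < v x")
    case True
    then have hx: "h x = v x - w x" and w'x: "w' x = v x" by (auto simp: h_def w'_def)
    have "\<forall>\<^sub>F \<epsilon> in at_right 0. h x * (c * trunc_lap p \<epsilon> v x) \<le> q x"
      using sub[of x] True unfolding q_def hx w'x by simp
    then have "\<forall>\<^sub>F i in sequentially. h x * (c * trunc_lap p (e i) v x) \<le> q x"
      using e_at by (rule eventually_compose_filterlim)
    then have "\<forall>\<^sub>F i in sequentially. m i x = q x" by (rule eventually_mono) (simp add: m_def max_def)
    then show ?thesis by (rule tendsto_eventually)
  next
    case False
    then have "h x = 0" using h_off[of x] by (auto simp: h_def w'_def)
    then have "m i x = q x" for i by (simp add: m_def q_def h_def)
    then show ?thesis by simp
  qed
  have M_int: "integrable lborel (\<lambda>x. M * indicator \<Omega> x)"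
    using emeasure_bounded_finite[OF bd] by simp
  have q_meas [measurable]: "q \<in> borel_measurable borel" unfolding q_def h_def by measurable
  have m_int: "integrable lborel (m i)" for i
    by (rule Bochner_Integration.integrable_bound[OF M_int]) (use order_trans[OF mM abs_ge_self] in auto)
  have int_lim: "(\<lambda>i. \<integral>x. m i x \<partial>lborel) \<longlonglongrightarrow> (\<integral>x. q x \<partial>lborel)"
    by (rule integral_dominated_convergence[OF _ _ M_int]) (use m_lim mM in auto)
  define d where "d = enn2real (dirichlet p 0 \<Omega> w)"
  have main: "dirichlet p (e i) \<Omega> w' \<le> ennreal (d + 4 / c * (\<integral>x. m i x \<partial>lborel))"
    and main0: "0 \<le> d + 4 / c * (\<integral>x. m i x \<partial>lborel)" for i
  proof -
    note inc = dirichlet_increment[OF p e0[of i] \<Omega> bd w_meas w'_meas B(1) B' off']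
    note fin' = dirichlet_increment(1)[OF p e0[of i] \<Omega> bd w'_meas w'_meas B' B' refl]
    have "(\<integral>x. h x * trunc_lap p (e i) w' x \<partial>lborel) \<le> (\<integral>x. (1 / c) * m i x \<partial>lborel)"
    proof (rule integral_mono)
      show "integrable lborel (\<lambda>x. h x * trunc_lap p (e i) w' x)" using inc(3) by (simp add: h_def)
      show "integrable lborel (\<lambda>x. (1 / c) * m i x)" using m_int by (rule integrable_mult_right)
      fix x
      show "h x * trunc_lap p (e i) w' x \<le> (1 / c) * m i x"
      proof (cases "h x = 0")
        case True then show ?thesis using c by (simp add: m_def q_def h_def divide_simps)
      next
        case False
        then have xv: "w' x = v x" unfolding h_def w'_def by (auto simp: max_def split: if_splits)
        have le: "trunc_lap p (e i) w' x \<le> trunc_lap p (e i) v x"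
          unfolding trunc_lap_def
        proof (rule integral_mono)
          have "\<bar>w' x - w' y\<bar> \<le> 2 * B" "\<bar>v x - v y\<bar> \<le> 2 * B" for y
            using B'[of x] B'[of y] B(2)[of x] B(2)[of y] by linarith+
          then show "integrable lborel (\<lambda>y. (w' x - w' y) * trunc_kernel p (e i) (x - y))"
             "integrable lborel (\<lambda>y. (v x - v y) * trunc_kernel p (e i) (x - y))"
            by (auto intro!: bounded_mult_trunc_kernel_integrable[OF p e0])
          show "(w' x - w' y) * trunc_kernel p (e i) (x - y) \<le> (v x - v y) * trunc_kernel p (e i) (x - y)" for y
            by (intro mult_right_mono) (auto simp: xv, simp add: w'_def)
        qed
        have "h x * trunc_lap p (e i) w' x \<le> h x * trunc_lap p (e i) v x"
          using le h0 by (intro mult_left_mono) auto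
        also have "\<dots> = (1 / c) * (h x * (c * trunc_lap p (e i) v x))" using c by simp
        also have "\<dots> \<le> (1 / c) * m i x" using c by (intro mult_left_mono) (auto simp: m_def)
        finally show ?thesis .
      qed
    qed
    then have "4 * (\<integral>x. h x * trunc_lap p (e i) w' x \<partial>lborel) \<le> 4 / c * (\<integral>x. m i x \<partial>lborel)"
      by simp
    moreover have "enn2real (dirichlet p (e i) \<Omega> w) \<le> d"
      unfolding d_def using fin e0[of i] by (intro enn2real_mono dirichlet_antimono) auto
    ultimately have "enn2real (dirichlet p (e i) \<Omega> w') \<le> d + 4 / c * (\<integral>x. m i x \<partial>lborel)"
      using inc(2) unfolding h_def by simp
    note real_le = this
    have "dirichlet p (e i) \<Omega> w' = ennreal (enn2real (dirichlet p (e i) \<Omega> w'))"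
      using fin' by simp
    then show "dirichlet p (e i) \<Omega> w' \<le> ennreal (d + 4 / c * (\<integral>x. m i x \<partial>lborel))"
      using ennreal_leI[OF real_le] by (rule ord_eq_le_trans)
    show "0 \<le> d + 4 / c * (\<integral>x. m i x \<partial>lborel)"
      using enn2real_nonneg real_le by (rule order_trans)
  qed
  define D where "D = d + 4 / c * (\<integral>x. q x \<partial>lborel)"
  have lim: "(\<lambda>i. d + 4 / c * (\<integral>x. m i x \<partial>lborel)) \<longlonglongrightarrow> D"
    unfolding D_def by (intro tendsto_intros int_lim)
  have D0: "D \<ge> 0" using lim main0 by (intro LIMSEQ_le_const) auto
  have "dirichlet p 0 \<Omega> w' \<le> liminf (\<lambda>i. dirichlet p (e i) \<Omega> w')"
    using e_lim e0 by (intro dirichlet_le_liminf) (auto intro: less_imp_le)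
  also have "\<dots> \<le> liminf (\<lambda>i. ennreal (d + 4 / c * (\<integral>x. m i x \<partial>lborel)))"
    by (intro Liminf_mono always_eventually allI main)
  also have "\<dots> = ennreal D"
    using tendsto_ennrealI[OF lim] by (intro lim_imp_Liminf) auto
  finally have le: "dirichlet p 0 \<Omega> w' \<le> ennreal D" .
  then show "dirichlet p 0 \<Omega> w' < \<infinity>" by (simp add: le_less_trans[OF _ ennreal_less_top])
  have "enn2real (dirichlet p 0 \<Omega> w') \<le> D" using le D0 by (simp add: enn2real_leI)
  moreover have "(\<integral>x. q x \<partial>lborel) = (LINT x:\<Omega>|lborel. q x)"
    unfolding set_lebesgue_integral_def by (intro Bochner_Integration.integral_cong) (auto simp: indicator_def q_off)
  moreover have "(LINT x:\<Omega>|lborel. q x) = (LINT x:\<Omega>|lborel. F (w' x)) - (LINT x:\<Omega>|lborel. F (w x)) + \<kappa> * (LINT x:\<Omega>|lborel. w' x - w x)"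
  proof -
    have i1: "set_integrable lborel \<Omega> (\<lambda>x. F (w' x))" "set_integrable lborel \<Omega> (\<lambda>x. F (w x))"
      using Q(2) B B' by (auto intro!: bounded_set_integrable[OF \<Omega> bd])
    have "\<bar>w' x - w x\<bar> \<le> 2 * B" for x using h0[of x] hB[of x] by (simp add: h_def)
    then have i2: "set_integrable lborel \<Omega> (\<lambda>x. w' x - w x)"
      by (auto intro!: bounded_set_integrable[OF \<Omega> bd])
    show ?thesis unfolding q_def h_def using i1 i2
      by (simp add: set_integral_add set_integral_diff)
  qed
  ultimately have "enn2real (dirichlet p 0 \<Omega> w') \<le> d + 4 / c * ((LINT x:\<Omega>|lborel. F (w' x)) - (LINT x:\<Omega>|lborel. F (w x)) + \<kappa> * (LINT x:\<Omega>|lborel. w' x - w x))"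
    by (simp add: D_def)
  from mult_left_mono[OF this, of "c / 4"] c
  show "finite_energy c p F \<Omega> w' \<le> finite_energy c p F \<Omega> w + \<kappa> * (LINT x:\<Omega>|lborel. w' x - w x)"
    unfolding finite_energy_def d_def by (simp add: algebra_simps)
qed

section \<open>Sup-convolution\<close>

text \<open>
  For a continuous $u$ the pointwise equation gives no direct bound of the truncated operators that is
  uniform in $\epsilon$. Sup-convolution provides one on the side that matters: it is semiconvex, whence an
  upper bound, and it is touched from below, at each point and after a translation, by $u$ itself,
  whence it inherits the equation as an inequality.
\<close>
definition sup_conv :: "real \<Rightarrow> ('a::euclidean_space \<Rightarrow> real) \<Rightarrow> 'a \<Rightarrow> real" where
  "sup_conv \<delta> u x = (SUP y. u y - (norm (x - y))\<^sup>2 / \<delta>)"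

definition contact :: "real \<Rightarrow> ('a::euclidean_space \<Rightarrow> real) \<Rightarrow> 'a \<Rightarrow> 'a" where
  "contact \<delta> u x = (SOME y. \<forall>z. u z - (norm (x - z))\<^sup>2 / \<delta> \<le> u y - (norm (x - y))\<^sup>2 / \<delta>)"

text \<open>
  The supremum is attained because points farther than $\sqrt{2 M \delta}$ from $x$ lose at least
  $2M$, the largest possible gain in $u$, and so do no better than $x$ itself.
\<close>
lemma contact_maximal:
  fixes u :: "'a::euclidean_space \<Rightarrow> real"
  assumes u: "continuous_on UNIV u" and M: "\<And>x. \<bar>u x\<bar> \<le> M" and \<delta>: "\<delta> > 0"
  shows "u z - (norm (x - z))\<^sup>2 / \<delta> \<le> u (contact \<delta> u x) - (norm (x - contact \<delta> u x))\<^sup>2 / \<delta>"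
proof -
  let ?f = "\<lambda>y. u y - (norm (x - y))\<^sup>2 / \<delta>"
  have M0: "M \<ge> 0" using M[of 0] by linarith
  define r where "r = sqrt (2 * M * \<delta>)"
  have r0: "r \<ge> 0" and r2: "r\<^sup>2 = 2 * M * \<delta>" using M0 \<delta> by (simp_all add: r_def)
  have "continuous_on (cball x r) ?f"
    using \<delta> by (intro continuous_intros continuous_on_subset[OF u]) auto
  then obtain y where y: "y \<in> cball x r" "\<And>z. z \<in> cball x r \<Longrightarrow> ?f z \<le> ?f y"
    using continuous_attains_sup[of "cball x r" ?f] r0 by auto
  have "?f z \<le> ?f y" for z
  proof (cases "z \<in> cball x r")
    case False
    then have "r < norm (x - z)" by (simp add: dist_norm)
    then have "r\<^sup>2 \<le> (norm (x - z))\<^sup>2" using r0 by (intro power_mono) auto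
    then have "2 * M \<le> (norm (x - z))\<^sup>2 / \<delta>" using \<delta> unfolding r2 by (simp add: le_divide_eq)
    then have "?f z \<le> ?f x" using M[of z] M[of x] by simp
    also have "\<dots> \<le> ?f y" using r0 by (intro y(2)) simp
    finally show ?thesis .
  qed (rule y(2))
  then have "\<exists>y. \<forall>z. ?f z \<le> ?f y" by blast
  then show ?thesis unfolding contact_def by (rule someI2_ex) blast
qed

lemma sup_conv_contact:
  fixes u :: "'a::euclidean_space \<Rightarrow> real"
  assumes u: "continuous_on UNIV u" and M: "\<And>x. \<bar>u x\<bar> \<le> M" and \<delta>: "\<delta> > 0"
  shows "sup_conv \<delta> u x = u (contact \<delta> u x) - (norm (x - contact \<delta> u x))\<^sup>2 / \<delta>"
  unfolding sup_conv_def using contact_maximal[OF assms] by (intro cSup_eq_maximum) auto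

context
  fixes u :: "'a::euclidean_space \<Rightarrow> real" and M \<delta> :: real
  assumes u: "continuous_on UNIV u" and M: "\<And>x. \<bar>u x\<bar> \<le> M" and \<delta>: "\<delta> > 0"
begin

lemma sup_conv_ge: "u z - (norm (x - z))\<^sup>2 / \<delta> \<le> sup_conv \<delta> u x"
  using contact_maximal[OF u M \<delta>] sup_conv_contact[OF u M \<delta>] by simp

lemma sup_conv_ge_self: "u x \<le> sup_conv \<delta> u x"
  using sup_conv_ge[of x x] by simp

lemma sup_conv_le_contact: "sup_conv \<delta> u x \<le> u (contact \<delta> u x)"
  using sup_conv_contact[OF u M \<delta>] \<delta> by simp

lemma sup_conv_abs_le: "\<bar>sup_conv \<delta> u x\<bar> \<le> M"
  using sup_conv_ge_self[of x] sup_conv_le_contact[of x] M[of x] M[of "contact \<delta> u x"] by linarith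

lemma contact_dist: "(norm (x - contact \<delta> u x))\<^sup>2 / \<delta> \<le> u (contact \<delta> u x) - u x"
  using sup_conv_ge_self[of x] sup_conv_contact[OF u M \<delta>, of x] by simp

lemma contact_dist_le: "(norm (x - contact \<delta> u x))\<^sup>2 \<le> 2 * M * \<delta>"
proof -
  have "(norm (x - contact \<delta> u x))\<^sup>2 / \<delta> \<le> 2 * M"
    using contact_dist[of x] M[of x] M[of "contact \<delta> u x"] by linarith
  then show ?thesis using \<delta> by (simp add: divide_le_eq)
qed

text \<open>
  The contact point translated by $z$ is a candidate in the supremum at $x + z$, with the same
  penalty. So the increments of the sup-convolution at $x$ dominate those of $u$ at the contact
  point, and the nonlocal operators compare at every truncation level.
\<close>
lemma sup_conv_touch: "sup_conv \<delta> u x - sup_conv \<delta> u (x + z) \<le> u (contact \<delta> u x) - u (contact \<delta> u x + z)"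
  using sup_conv_ge[of "contact \<delta> u x + z" "x + z"] sup_conv_contact[OF u M \<delta>, of x] by simp

text \<open>
  The contact point of $x$ is a candidate at $x + z$ and at $x - z$; the parallelogram law adds up the
  two penalties.
\<close>
lemma sup_conv_semiconvex: "2 * sup_conv \<delta> u x - sup_conv \<delta> u (x + z) - sup_conv \<delta> u (x - z) \<le> 2 / \<delta> * (norm z)\<^sup>2"
proof -
  let ?y = "contact \<delta> u x"
  have "(norm (x + z - ?y))\<^sup>2 + (norm (x - z - ?y))\<^sup>2 = 2 * (norm (x - ?y))\<^sup>2 + 2 * (norm z)\<^sup>2"
    unfolding power2_norm_eq_inner by (simp add: algebra_simps inner_commute)
  then have "(norm (x + z - ?y))\<^sup>2 / \<delta> + (norm (x - z - ?y))\<^sup>2 / \<delta> = 2 * ((norm (x - ?y))\<^sup>2 / \<delta>) + 2 / \<delta> * (norm z)\<^sup>2"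
    by (simp add: add_divide_distrib[symmetric])
  then show ?thesis
    using sup_conv_ge[of ?y "x + z"] sup_conv_ge[of ?y "x - z"] sup_conv_contact[OF u M \<delta>, of x] by linarith
qed

lemma sup_conv_lipschitz:
  "\<bar>sup_conv \<delta> u x - sup_conv \<delta> u x'\<bar> \<le> norm (x - x') * (norm (x - x') + 2 * sqrt (2 * M * \<delta>)) / \<delta>"
proof -
  have half: "sup_conv \<delta> u x - sup_conv \<delta> u x' \<le> norm (x - x') * (norm (x - x') + 2 * sqrt (2 * M * \<delta>)) / \<delta>" for x x'
  proof -
    let ?y = "contact \<delta> u x"
    have r: "norm (x - ?y) \<le> sqrt (2 * M * \<delta>)" using contact_dist_le[of x] by (rule real_le_rsqrt)
    have "norm (x' - ?y) \<le> norm (x - ?y) + norm (x - x')" by norm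
    then have "(norm (x' - ?y))\<^sup>2 \<le> (norm (x - ?y) + norm (x - x'))\<^sup>2" by (intro power_mono) auto
    also have "\<dots> = (norm (x - ?y))\<^sup>2 + norm (x - x') * (norm (x - x') + 2 * norm (x - ?y))"
      by (simp add: power2_eq_square algebra_simps)
    also have "\<dots> \<le> (norm (x - ?y))\<^sup>2 + norm (x - x') * (norm (x - x') + 2 * sqrt (2 * M * \<delta>))"
      using r by (intro add_left_mono mult_left_mono) auto
    finally have "(norm (x' - ?y))\<^sup>2 / \<delta> \<le> (norm (x - ?y))\<^sup>2 / \<delta> + norm (x - x') * (norm (x - x') + 2 * sqrt (2 * M * \<delta>)) / \<delta>"
      using \<delta> by (simp add: add_divide_distrib[symmetric] divide_right_mono)
    then show ?thesis using sup_conv_ge[of ?y x'] sup_conv_contact[OF u M \<delta>, of x] by linarith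
  qed
  show ?thesis using half[of x x'] half[of x' x] by (simp add: norm_minus_commute abs_le_iff)
qed

lemma sup_conv_modulus:
  assumes "r > 0"
  obtains \<theta> where "\<theta> > 0" "\<And>x x'. norm (x - x') \<le> \<theta> \<Longrightarrow> \<bar>sup_conv \<delta> u x - sup_conv \<delta> u x'\<bar> \<le> r"
proof -
  define L where "L = (1 + 2 * sqrt (2 * M * \<delta>)) / \<delta>"
  have M0: "M \<ge> 0" using M[of 0] by linarith
  then have L: "L > 0" unfolding L_def using \<delta> by (intro divide_pos_pos add_pos_nonneg) auto
  show ?thesis
  proof (rule that[of "min 1 (r / L)"])
    show "min 1 (r / L) > 0" using assms L by simp
    fix x x' :: 'a
    assume a: "norm (x - x') \<le> min 1 (r / L)"
    have "norm (x - x') * (norm (x - x') + 2 * sqrt (2 * M * \<delta>)) / \<delta> \<le> norm (x - x') * (1 + 2 * sqrt (2 * M * \<delta>)) / \<delta>"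
      using a \<delta> by (intro divide_right_mono mult_left_mono) auto
    also have "\<dots> = norm (x - x') * L" by (simp add: L_def)
    also have "\<dots> \<le> r" using a L by (simp add: le_divide_eq)
    finally show "\<bar>sup_conv \<delta> u x - sup_conv \<delta> u x'\<bar> \<le> r"
      using sup_conv_lipschitz[of x x'] by linarith
  qed
qed

lemma continuous_on_sup_conv: "continuous_on UNIV (sup_conv \<delta> u)"
proof (rule continuous_onI)
  fix x :: 'a and r :: real
  assume "r > 0"
  then obtain \<theta> where "\<theta> > 0" "\<And>x x'. norm (x - x') \<le> \<theta> \<Longrightarrow> \<bar>sup_conv \<delta> u x - sup_conv \<delta> u x'\<bar> \<le> r"
    using sup_conv_modulus by metis
  then show "\<exists>d>0. \<forall>x'\<in>UNIV. dist x' x < d \<longrightarrow> dist (sup_conv \<delta> u x') (sup_conv \<delta> u x) \<le> r"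
    by (intro exI[of _ \<theta>]) (auto simp: dist_norm)
qed

end

lemma trunc_lap_eq_difference:
  fixes v :: "'a::euclidean_space \<Rightarrow> real"
  assumes [measurable]: "v \<in> borel_measurable borel"
  shows "trunc_lap p \<epsilon> v x = (\<integral>z. (v x - v (x - z)) * trunc_kernel p \<epsilon> z \<partial>lborel)"
    and "trunc_lap p \<epsilon> v x = (\<integral>z. (v x - v (x + z)) * trunc_kernel p \<epsilon> z \<partial>lborel)"
proof -
  show a: "trunc_lap p \<epsilon> v x = (\<integral>z. (v x - v (x - z)) * trunc_kernel p \<epsilon> z \<partial>lborel)"
    unfolding trunc_lap_def
    using integral_lborel_reflect[of "\<lambda>z. (v x - v (x - z)) * trunc_kernel p \<epsilon> z" x] by simp
  show "trunc_lap p \<epsilon> v x = (\<integral>z. (v x - v (x + z)) * trunc_kernel p \<epsilon> z \<partial>lborel)"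
    unfolding a using integral_lborel_reflect[of "\<lambda>z. (v x - v (x - z)) * trunc_kernel p \<epsilon> z" 0] by simp
qed

lemma trunc_lap_integrable:
  fixes v :: "'a::euclidean_space \<Rightarrow> real"
  assumes p: "real DIM('a) < p" "p < real DIM('a) + 2" and \<epsilon>: "\<epsilon> > 0"
    and [measurable]: "v \<in> borel_measurable borel" and B: "\<And>x. \<bar>v x\<bar> \<le> B"
  shows "integrable lborel (\<lambda>z. (v x - v (x - z)) * trunc_kernel p \<epsilon> z)"
    and "integrable lborel (\<lambda>z. (v x - v (x + z)) * trunc_kernel p \<epsilon> z)"
proof -
  have "\<bar>v x - v y\<bar> \<le> 2 * B" for y using B[of x] B[of y] by linarith
  then show "integrable lborel (\<lambda>z. (v x - v (x - z)) * trunc_kernel p \<epsilon> z)"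
    "integrable lborel (\<lambda>z. (v x - v (x + z)) * trunc_kernel p \<epsilon> z)"
    using bounded_mult_trunc_kernel_integrable[OF p \<epsilon>, of "\<lambda>z. v x - v (x - z)" "2 * B" 0]
      bounded_mult_trunc_kernel_integrable[OF p \<epsilon>, of "\<lambda>z. v x - v (x + z)" "2 * B" 0]
    by simp_all
qed

text \<open>
  Averaging over $z$ and $-z$ replaces the first difference, which need not be integrable against the
  full kernel, by a second difference of order $|z|^2$. This makes the bound independent of $\epsilon$.
\<close>
lemma trunc_lap_le_semiconvex:
  fixes v :: "'a::euclidean_space \<Rightarrow> real"
  assumes p: "real DIM('a) < p" "p < real DIM('a) + 2" and \<epsilon>: "\<epsilon> > 0"
    and [measurable]: "v \<in> borel_measurable borel" and B: "\<And>x. \<bar>v x\<bar> \<le> B"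
    and N: "\<And>z. norm z < 1 \<Longrightarrow> 2 * v x - v (x + z) - v (x - z) \<le> N * (norm z)\<^sup>2"
  shows "trunc_lap p \<epsilon> v x \<le> (\<bar>N\<bar> + 4 * B) / 2 * (\<integral>z. min 1 ((norm z)\<^sup>2) / norm (z::'a) powr p \<partial>lborel)"
proof -
  note int = trunc_lap_integrable[OF p \<epsilon> _ B]
  have B0: "B \<ge> 0" using B[of 0] by linarith
  have "2 * trunc_lap p \<epsilon> v x = (\<integral>z. (v x - v (x + z)) * trunc_kernel p \<epsilon> z \<partial>lborel) + (\<integral>z. (v x - v (x - z)) * trunc_kernel p \<epsilon> z \<partial>lborel)"
    using trunc_lap_eq_difference[of v p \<epsilon> x] by simp
  also have "\<dots> = (\<integral>z. (v x - v (x + z)) * trunc_kernel p \<epsilon> z + (v x - v (x - z)) * trunc_kernel p \<epsilon> z \<partial>lborel)"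
    by (intro Bochner_Integration.integral_add[symmetric] int) simp_all
  also have "\<dots> \<le> (\<integral>z. (\<bar>N\<bar> + 4 * B) * (min 1 ((norm z)\<^sup>2) / norm (z::'a) powr p) \<partial>lborel)"
  proof (rule integral_mono)
    show "integrable lborel (\<lambda>z. (v x - v (x + z)) * trunc_kernel p \<epsilon> z + (v x - v (x - z)) * trunc_kernel p \<epsilon> z)"
      by (intro Bochner_Integration.integrable_add int) simp_all
    show "integrable lborel (\<lambda>z::'a. (\<bar>N\<bar> + 4 * B) * (min 1 ((norm z)\<^sup>2) / norm z powr p))"
      by (intro integrable_mult_right singular_kernel_mass p)
    fix z :: 'a
    have "2 * v x - v (x + z) - v (x - z) \<le> (\<bar>N\<bar> + 4 * B) * min 1 ((norm z)\<^sup>2)"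
    proof (cases "norm z < 1")
      case True
      then have "(norm z)\<^sup>2 \<le> 1" by (simp add: power_le_one)
      moreover have "N * (norm z)\<^sup>2 \<le> (\<bar>N\<bar> + 4 * B) * (norm z)\<^sup>2"
        using B0 by (intro mult_right_mono) auto
      ultimately show ?thesis using N[OF True] by (simp add: min_absorb2)
    next
      case False
      then have "1 \<le> (norm z)\<^sup>2" by (simp add: one_le_power)
      then show ?thesis using B[of x] B[of "x + z"] B[of "x - z"] by (simp add: min_absorb1)
    qed
    moreover have "trunc_kernel p \<epsilon> z \<le> 1 / norm z powr p" by (simp add: trunc_kernel_def)
    moreover have "(\<bar>N\<bar> + 4 * B) * min 1 ((norm z)\<^sup>2) \<ge> 0" using B0 by simp
    ultimately have "(2 * v x - v (x + z) - v (x - z)) * trunc_kernel p \<epsilon> z \<le> (\<bar>N\<bar> + 4 * B) * min 1 ((norm z)\<^sup>2) * (1 / norm z powr p)"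
      by (intro mult_mono) auto
    then show "(v x - v (x + z)) * trunc_kernel p \<epsilon> z + (v x - v (x - z)) * trunc_kernel p \<epsilon> z \<le> (\<bar>N\<bar> + 4 * B) * (min 1 ((norm z)\<^sup>2) / norm z powr p)"
      by (simp add: algebra_simps add_divide_distrib)
  qed
  also have "\<dots> = (\<bar>N\<bar> + 4 * B) * (\<integral>z. min 1 ((norm z)\<^sup>2) / norm (z::'a) powr p \<partial>lborel)"
    by (rule integral_mult_right_zero)
  finally show ?thesis by simp
qed

text \<open>
  The tail allowance $E$ is for functions that have been altered far away: it costs only the mass of
  the kernel outside a large ball.
\<close>
lemma trunc_lap_compare:
  fixes u v :: "'a::euclidean_space \<Rightarrow> real"
  assumes p: "real DIM('a) < p" "p < real DIM('a) + 2" and \<epsilon>: "\<epsilon> > 0" "\<rho> > 0"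
    and [measurable]: "v \<in> borel_measurable borel" "u \<in> borel_measurable borel"
    and B: "\<And>x. \<bar>v x\<bar> \<le> B" "\<And>x. \<bar>u x\<bar> \<le> B"
    and near: "\<And>z. norm z \<le> \<rho> \<Longrightarrow> v x - v (x + z) \<le> u y - u (y + z)"
    and far: "\<And>z. v x - v (x + z) \<le> u y - u (y + z) + E" and E: "E \<ge> 0"
  shows "trunc_lap p \<epsilon> v x \<le> trunc_lap p \<epsilon> u y + E * (\<integral>z. trunc_kernel p \<rho> (z::'a) \<partial>lborel)"
proof -
  note int = trunc_lap_integrable(2)[OF p \<epsilon>(1)] and K = trunc_kernel_integrable[OF p \<epsilon>(2)]
  have "trunc_lap p \<epsilon> v x = (\<integral>z. (v x - v (x + z)) * trunc_kernel p \<epsilon> z \<partial>lborel)"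
    by (rule trunc_lap_eq_difference) simp
  also have "\<dots> \<le> (\<integral>z. (u y - u (y + z)) * trunc_kernel p \<epsilon> z + E * trunc_kernel p \<rho> z \<partial>lborel)"
  proof (rule integral_mono)
    show "integrable lborel (\<lambda>z. (v x - v (x + z)) * trunc_kernel p \<epsilon> z)"
      using B by (intro int[where B = B]) auto
    show "integrable lborel (\<lambda>z. (u y - u (y + z)) * trunc_kernel p \<epsilon> z + E * trunc_kernel p \<rho> z)"
      using B K by (intro Bochner_Integration.integrable_add integrable_mult_right int[where B = B]) auto
    fix z :: 'a
    show "(v x - v (x + z)) * trunc_kernel p \<epsilon> z \<le> (u y - u (y + z)) * trunc_kernel p \<epsilon> z + E * trunc_kernel p \<rho> z"
    proof (cases "norm z \<le> \<rho>")
      case True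
      then have "(v x - v (x + z)) * trunc_kernel p \<epsilon> z \<le> (u y - u (y + z)) * trunc_kernel p \<epsilon> z"
        by (intro mult_right_mono near) auto
      then show ?thesis using E by (simp add: add_increasing2)
    next
      case False
      then have "E * trunc_kernel p \<epsilon> z \<le> E * trunc_kernel p \<rho> z"
        using E by (intro mult_left_mono) (auto simp: trunc_kernel_def)
      moreover have "(v x - v (x + z)) * trunc_kernel p \<epsilon> z \<le> (u y - u (y + z) + E) * trunc_kernel p \<epsilon> z"
        by (intro mult_right_mono far) auto
      ultimately show ?thesis by (simp add: algebra_simps)
    qed
  qed
  also have "\<dots> = (\<integral>z. (u y - u (y + z)) * trunc_kernel p \<epsilon> z \<partial>lborel) + E * (\<integral>z. trunc_kernel p \<rho> (z::'a) \<partial>lborel)"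
    using B K by (subst Bochner_Integration.integral_add) (auto intro!: int[where B = B])
  also have "(\<integral>z. (u y - u (y + z)) * trunc_kernel p \<epsilon> z \<partial>lborel) = trunc_lap p \<epsilon> u y"
    by (rule trunc_lap_eq_difference(2)[symmetric]) simp
  finally show ?thesis .
qed

lemma trunc_kernel_tail:
  assumes p: "real DIM('a::euclidean_space) < p" "p < real DIM('a) + 2"
  shows "(\<lambda>i. \<integral>z. trunc_kernel p (real i) (z::'a) \<partial>lborel) \<longlonglongrightarrow> 0"
proof -
  have "(\<lambda>i. \<integral>z. trunc_kernel p (real (Suc i)) (z::'a) \<partial>lborel) \<longlonglongrightarrow> (\<integral>z. 0 \<partial>(lborel :: 'a measure))"
  proof (rule integral_dominated_convergence)
    show "integrable lborel (trunc_kernel p 1 :: 'a \<Rightarrow> real)" by (rule trunc_kernel_integrable[OF p]) simp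
    show "AE z in lborel. (\<lambda>i. trunc_kernel p (real (Suc i)) (z::'a)) \<longlonglongrightarrow> 0"
    proof (rule AE_I2)
      fix z :: 'a
      have "\<forall>\<^sub>F i in sequentially. trunc_kernel p (real (Suc i)) z = 0"
        using eventually_ge_at_top[of "nat \<lceil>norm z\<rceil>"]
        by eventually_elim (simp add: trunc_kernel_def nat_le_iff ceiling_le_iff)
      then show "(\<lambda>i. trunc_kernel p (real (Suc i)) z) \<longlonglongrightarrow> 0" by (rule tendsto_eventually)
    qed
    show "AE z in lborel. norm (trunc_kernel p (real (Suc i)) (z::'a)) \<le> trunc_kernel p 1 z" for i
      by (intro AE_I2) (auto intro!: trunc_kernel_antimono)
  qed measurable
  then show ?thesis by (subst (asm) filterlim_sequentially_Suc) simp
qed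

section \<open>Sliding the regularized translates\<close>

text \<open>
  A translate of the sup-convolution, lowered by $\eta$ so that it lies below the corresponding
  translate of $u$. The lowering rests on the uniform continuity of $u$ on a ball; outside a
  large ball the function is therefore replaced by the lower bound $-M$ of $u$, which only affects the
  tail of the nonlocal operator.
\<close>
definition leaf :: "real \<Rightarrow> real \<Rightarrow> real \<Rightarrow> real \<Rightarrow> ('a::euclidean_space \<Rightarrow> real) \<Rightarrow> 'a \<Rightarrow> 'a \<Rightarrow> real" where
  "leaf M R \<eta> \<delta> u a x = (if norm x < R then sup_conv \<delta> u (x + a) - \<eta> else - M)"

context
  fixes u :: "'a::euclidean_space \<Rightarrow> real" and M \<delta> \<eta> R :: real
  assumes u: "continuous_on UNIV u" and M: "\<And>x. \<bar>u x\<bar> \<le> M" and \<delta>: "\<delta> > 0"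
    and \<eta>: "0 \<le> \<eta>" "\<eta> \<le> 1"
begin

lemma leaf_measurable [measurable]: "leaf M R \<eta> \<delta> u a \<in> borel_measurable borel"
proof -
  have [measurable]: "sup_conv \<delta> u \<in> borel_measurable borel"
    using continuous_on_sup_conv[OF u M \<delta>] by (rule borel_measurable_continuous_onI)
  show ?thesis unfolding leaf_def[abs_def] by measurable
qed

lemma leaf_abs_le: "\<bar>leaf M R \<eta> \<delta> u a x\<bar> \<le> M + 1"
  using sup_conv_abs_le[OF u M \<delta>, of "x + a"] \<eta> M[of 0] unfolding leaf_def by auto

lemma trunc_lap_leaf_bounded:
  assumes p: "real DIM('a) < p" "p < real DIM('a) + 2" and \<epsilon>: "\<epsilon> > 0" and x: "norm x + 1 \<le> R"
  shows "trunc_lap p \<epsilon> (leaf M R \<eta> \<delta> u a) x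
    \<le> (\<bar>2 / \<delta>\<bar> + 4 * (M + 1)) / 2 * (\<integral>z. min 1 ((norm z)\<^sup>2) / norm (z::'a) powr p \<partial>lborel)"
proof (rule trunc_lap_le_semiconvex[OF p \<epsilon> leaf_measurable leaf_abs_le])
  fix z :: 'a
  assume "norm z < 1"
  then have "norm x < R" "norm (x + z) < R" "norm (x - z) < R"
    using x norm_triangle_ineq[of x z] norm_triangle_ineq4[of x z] norm_ge_zero[of z] by linarith+
  then show "2 * leaf M R \<eta> \<delta> u a x - leaf M R \<eta> \<delta> u a (x + z) - leaf M R \<eta> \<delta> u a (x - z) \<le> 2 / \<delta> * (norm z)\<^sup>2"
    using sup_conv_semiconvex[OF u M \<delta>, of "x + a" z] by (simp add: leaf_def algebra_simps)
qed

lemma trunc_lap_leaf_le: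
  assumes p: "real DIM('a) < p" "p < real DIM('a) + 2" and \<epsilon>: "\<epsilon> > 0" "\<rho> > 0" and x: "norm x + \<rho> < R"
  shows "trunc_lap p \<epsilon> (leaf M R \<eta> \<delta> u a) x
    \<le> trunc_lap p \<epsilon> u (contact \<delta> u (x + a)) + 4 * M * (\<integral>z. trunc_kernel p \<rho> (z::'a) \<partial>lborel)"
proof (rule trunc_lap_compare[OF p \<epsilon> leaf_measurable _ leaf_abs_le])
  let ?y = "contact \<delta> u (x + a)" and ?v = "leaf M R \<eta> \<delta> u a"
  have M0: "M \<ge> 0" using M[of 0] by linarith
  show "u \<in> borel_measurable borel" using u by (rule borel_measurable_continuous_onI)
  show "\<bar>u x\<bar> \<le> M + 1" for x using M[of x] by linarith
  show "0 \<le> 4 * M" using M0 by simp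
  have xR: "norm x < R" using x \<epsilon> by linarith
  have inside: "?v x - ?v (x + z) \<le> u ?y - u (?y + z)" if "norm (x + z) < R" for z
    using sup_conv_touch[OF u M \<delta>, of "x + a" z] that xR by (simp add: leaf_def algebra_simps)
  show "?v x - ?v (x + z) \<le> u ?y - u (?y + z)" if "norm z \<le> \<rho>" for z
    using that x norm_triangle_ineq[of x z] by (intro inside) linarith
  show "?v x - ?v (x + z) \<le> u ?y - u (?y + z) + 4 * M" for z
  proof (cases "norm (x + z) < R")
    case True then show ?thesis using inside[OF True] M0 by linarith
  next
    case False
    then have "?v x - ?v (x + z) \<le> 2 * M"
      using xR \<eta> sup_conv_abs_le[OF u M \<delta>, of "x + a"] by (simp add: leaf_def)
    then show ?thesis using M[of ?y] M[of "?y + z"] by linarith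
  qed
qed

end

lemma leaf_mono:
  fixes u :: "'a::euclidean_space \<Rightarrow> real"
  assumes u: "continuous_on UNIV u" and M: "\<And>x. \<bar>u x\<bar> \<le> M" and \<delta>: "\<delta> > 0"
    and mono: "\<And>x s t. s \<le> t \<Longrightarrow> u (x + s *\<^sub>R e) \<le> u (x + t *\<^sub>R e)" and st: "s \<le> t"
  shows "leaf M R \<eta> \<delta> u (s *\<^sub>R e) x \<le> leaf M R \<eta> \<delta> u (t *\<^sub>R e) x"
proof -
  let ?y = "contact \<delta> u (x + s *\<^sub>R e)"
  have "sup_conv \<delta> u (x + s *\<^sub>R e) - sup_conv \<delta> u (x + s *\<^sub>R e + (t - s) *\<^sub>R e) \<le> u ?y - u (?y + (t - s) *\<^sub>R e)"
    by (rule sup_conv_touch[OF u M \<delta>])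
  also have "\<dots> \<le> 0" using mono[of 0 "t - s" ?y] st by simp
  finally show ?thesis by (simp add: leaf_def algebra_simps)
qed

lemma set_integral_abs_le:
  fixes f :: "'a::euclidean_space \<Rightarrow> real"
  assumes "\<Omega> \<in> sets borel" "bounded \<Omega>" "f \<in> borel_measurable borel" "\<And>x. x \<in> \<Omega> \<Longrightarrow> \<bar>f x\<bar> \<le> B"
  shows "(LINT x:\<Omega>|lborel. f x) \<le> B * measure lborel \<Omega>"
proof -
  have "(LINT x:\<Omega>|lborel. f x) \<le> (LINT x:\<Omega>|lborel. B)"
    using assms by (intro set_integral_mono bounded_set_integrable[where B = B] bounded_set_integrable[where B = "\<bar>B\<bar>"]) (auto simp: abs_le_iff)
  also have "\<dots> = B * measure lborel \<Omega>"
    using assms emeasure_bounded_finite[of \<Omega>] by (subst set_integral_const) auto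
  finally show ?thesis .
qed

text \<open>
  For a competitor $w$ the leaves with parameters $0 \<ge> t_j = -Tj/N \<ge> -T$ are used one after the
  other, from $j = N$ up to $j = 0$, to raise $w$. Consecutive leaves differ by very little, so in a
  step from $j + 1$ to $j$ the difference quotient of $F$ is nearly $f$ at the contact value, and the
  leaf is a subsolution up to $\kappa$. The increments of all these steps telescope, hence their total
  cost is $\kappa$ times a bounded quantity, whatever $N$ is. The very first step, from $w$ to its
  maximum with the lowest leaf, may be large; there only the crude constant $2A + \kappa$ is
  available, but that leaf lies below $u(x - Te)$, and the integral it multiplies is small when $T$ is
  large. The function $v$ that is obtained is the top leaf.
\<close>
lemma near_max_energy_le:
  fixes u :: "'a::euclidean_space \<Rightarrow> real"
  assumes p: "real DIM('a) < p" "p < real DIM('a) + 2" and c: "c > 0"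
    and \<Omega> [measurable]: "\<Omega> \<in> sets borel" and bd: "bounded \<Omega>"
    and F: "\<And>r. (F has_real_derivative f r) (at r)" and f: "continuous_on UNIV f"
    and A: "\<And>r. \<bar>r\<bar> \<le> M + 1 \<Longrightarrow> \<bar>f r\<bar> \<le> A"
    and u: "continuous_on UNIV u" and M: "\<And>x. \<bar>u x\<bar> \<le> M"
    and sol: "\<And>x. ((\<lambda>\<epsilon>. c * trunc_lap p \<epsilon> u x) \<longlongrightarrow> f (u x)) (at_right 0)"
    and mono: "\<And>x s t. s \<le> t \<Longrightarrow> u (x + s *\<^sub>R e) \<le> u (x + t *\<^sub>R e)"
    and T: "T > 0" and \<kappa>: "0 < \<kappa>" "\<kappa> \<le> 1"
  obtains v where "v \<in> borel_measurable borel" "\<And>x. \<bar>v x\<bar> \<le> M + 1" "\<And>x. v x \<le> u x"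
    "\<And>x. norm x \<le> 1 / \<kappa> \<Longrightarrow> u x - \<kappa> \<le> v x"
    "\<And>w. \<lbrakk>w \<in> borel_measurable borel; \<And>x. \<bar>w x\<bar> \<le> M; \<And>x. x \<notin> \<Omega> \<Longrightarrow> w x = u x; dirichlet p 0 \<Omega> w < \<infinity>\<rbrakk>
      \<Longrightarrow> dirichlet p 0 \<Omega> (\<lambda>x. max (w x) (v x)) < \<infinity> \<and>
        finite_energy c p F \<Omega> (\<lambda>x. max (w x) (v x)) \<le> finite_energy c p F \<Omega> w
          + \<kappa> * ((2 * M + 2) * measure lborel \<Omega>)
          + (2 * A + \<kappa>) * (LINT x:\<Omega>|lborel. max 0 (u (x - T *\<^sub>R e) - w x))"
proof -
  have M0: "M \<ge> 0" using M[of 0] by linarith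
  have A0: "A \<ge> 0" using A[of 0] M0 by simp
  have contF: "continuous_on UNIV F"
    using F by (intro continuous_at_imp_continuous_on) (auto intro: DERIV_isCont)
  \<comment> \<open>The order of the choices matters: r from the modulus of f, then \<eta> from r, the ball radius R from
    the kernel tail, the regularization \<delta> from the modulus of u on a ball slightly larger than all
    points met when sliding by at most T, and the number N of steps from the modulus of the
    sup-convolution.\<close>
  have "uniformly_continuous_on {-(M+1)..M+1} f"
    by (intro compact_uniformly_continuous continuous_on_subset[OF f]) auto
  then obtain r0 where r0: "r0 > 0" "\<forall>a\<in>{-(M+1)..M+1}. \<forall>b\<in>{-(M+1)..M+1}. dist b a < r0 \<longrightarrow> dist (f b) (f a) < \<kappa> / 2"
    unfolding uniformly_continuous_on_def using half_gt_zero[OF \<kappa>(1)] by meson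
  define r where "r = r0 / 2"
  have r: "r > 0" "\<And>a b. \<lbrakk>\<bar>a\<bar> \<le> M + 1; \<bar>b\<bar> \<le> M + 1; \<bar>a - b\<bar> \<le> r\<rbrakk> \<Longrightarrow> f a \<le> f b + \<kappa> / 2"
  proof -
    show "r > 0" using r0(1) by (simp add: r_def)
    fix a b assume "\<bar>a\<bar> \<le> M + 1" "\<bar>b\<bar> \<le> M + 1" "\<bar>a - b\<bar> \<le> r"
    then have "dist (f a) (f b) < \<kappa> / 2" using r0(1)
      by (intro r0(2)[rule_format]) (auto simp: dist_real_def r_def abs_le_iff)
    then show "f a \<le> f b + \<kappa> / 2" unfolding dist_real_def by linarith
  qed
  define \<eta> where "\<eta> = min (r / 4) \<kappa>"
  have \<eta>: "0 < \<eta>" "0 \<le> \<eta>" "\<eta> \<le> 1" "\<eta> \<le> r / 4" "\<eta> \<le> \<kappa>" using r \<kappa> by (auto simp: \<eta>_def)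
  obtain R0 where R0: "R0 > 0" "\<And>x. x \<in> \<Omega> \<Longrightarrow> norm x \<le> R0"
    using bd unfolding bounded_pos by auto
  have "(\<lambda>i. c * (4 * M * (\<integral>z. trunc_kernel p (real i) (z::'a) \<partial>lborel))) \<longlonglongrightarrow> c * (4 * M * 0)"
    by (intro tendsto_intros trunc_kernel_tail p)
  then have "\<forall>\<^sub>F i in sequentially. c * (4 * M * (\<integral>z. trunc_kernel p (real i) (z::'a) \<partial>lborel)) < \<kappa> / 4"
    using \<kappa> by (intro order_tendstoD) auto
  then obtain i where i: "i \<ge> max 1 (nat \<lceil>1 / \<kappa>\<rceil>)" "c * (4 * M * (\<integral>z. trunc_kernel p (real i) (z::'a) \<partial>lborel)) < \<kappa> / 4"
    unfolding eventually_sequentially by (metis max.cobounded1 max.cobounded2)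
  define \<rho> where "\<rho> = real i"
  have \<rho>: "\<rho> \<ge> 1" "\<rho> \<ge> 1 / \<kappa>" "c * (4 * M * (\<integral>z. trunc_kernel p \<rho> (z::'a) \<partial>lborel)) < \<kappa> / 4"
    using i by (auto simp: \<rho>_def nat_le_iff ceiling_le_iff)
  define R where "R = R0 + \<rho> + 1"
  have inR: "norm x + \<rho> < R" "norm x + 1 \<le> R" "norm x < R" if "x \<in> \<Omega>" for x
    using R0(2)[OF that] \<rho> by (auto simp: R_def)
  define S where "S = R + T * norm e + 1"
  have "uniformly_continuous_on (cball 0 S) u"
    by (intro compact_uniformly_continuous continuous_on_subset[OF u]) auto
  then obtain \<theta>0 where \<theta>0: "\<theta>0 > 0" "\<forall>a\<in>cball 0 S. \<forall>b\<in>cball 0 S. dist b a < \<theta>0 \<longrightarrow> dist (u b) (u a) < \<eta>"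
    unfolding uniformly_continuous_on_def using \<eta>(1) by meson
  define \<theta> where "\<theta> = min 1 (\<theta>0 / 2)"
  have \<theta>: "0 < \<theta>" "\<theta> \<le> 1" "\<And>a b. \<lbrakk>norm a \<le> S; norm b \<le> S; norm (a - b) \<le> \<theta>\<rbrakk> \<Longrightarrow> \<bar>u a - u b\<bar> \<le> \<eta>"
  proof -
    show "0 < \<theta>" "\<theta> \<le> 1" using \<theta>0(1) by (auto simp: \<theta>_def)
    fix a b :: 'a assume "norm a \<le> S" "norm b \<le> S" "norm (a - b) \<le> \<theta>"
    then have "dist (u a) (u b) < \<eta>" using \<theta>0(1)
      by (intro \<theta>0(2)[rule_format]) (auto simp: dist_norm \<theta>_def)
    then show "\<bar>u a - u b\<bar> \<le> \<eta>" by (simp add: dist_real_def)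
  qed
  \<comment> \<open>Contact points are then within \<theta>; the summand 1 covers the case M = 0.\<close>
  define \<delta> where "\<delta> = \<theta>\<^sup>2 / (2 * M + 1)"
  have \<delta>: "\<delta> > 0" unfolding \<delta>_def using \<theta> M0 by simp
  have "2 * M * \<delta> \<le> (2 * M + 1) * \<delta>" using \<delta> by simp
  also have "\<dots> = \<theta>\<^sup>2" using M0 by (simp add: \<delta>_def)
  finally have M\<delta>: "2 * M * \<delta> \<le> \<theta>\<^sup>2" .
  let ?g = "sup_conv \<delta> u" and ?y = "contact \<delta> u"
  have y_near: "norm (x - ?y x) \<le> \<theta>" for x
    using order_trans[OF contact_dist_le[OF u M \<delta>] M\<delta>] less_imp_le[OF \<theta>(1)] by (rule power2_le_imp_le)
  have uy: "u (?y x) \<le> u x + \<eta>" if "norm x \<le> R + T * norm e" for x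
  proof -
    have "norm (?y x) \<le> norm x + norm (x - ?y x)" by norm
    then have "norm (?y x) \<le> S" "norm x \<le> S" using y_near[of x] \<theta>(2) that by (auto simp: S_def)
    then show ?thesis using \<theta>(3)[of x "?y x"] y_near[of x] by linarith
  qed
  have g_le: "?g x \<le> u x + \<eta>" and g_ge: "u (?y x) - \<eta> \<le> ?g x" if "norm x \<le> R + T * norm e" for x
    using uy[OF that] sup_conv_le_contact[OF u M \<delta>, of x] contact_dist[OF u M \<delta>, of x] sup_conv_contact[OF u M \<delta>, of x]
    by linarith+
  obtain \<theta>' where \<theta>': "\<theta>' > 0" "\<And>x x'. norm (x - x') \<le> \<theta>' \<Longrightarrow> \<bar>?g x - ?g x'\<bar> \<le> r / 4"
    using sup_conv_modulus[OF u M \<delta>, of "r / 4"] r by auto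
  obtain N0 :: nat where N0: "T * norm e / \<theta>' < real N0" using reals_Archimedean2 by blast
  define N where "N = Suc N0"
  have "T * norm e < real N * \<theta>'"
    using N0 \<theta>'(1) unfolding N_def by (simp add: pos_divide_less_eq algebra_simps)
  then have N: "T / real N * norm e \<le> \<theta>'" "N > 0"
    by (simp_all add: N_def pos_divide_le_eq mult.commute)
  define v where "v = (\<lambda>j. leaf M R \<eta> \<delta> u ((- (T / real N * real j)) *\<^sub>R e))"
  note leaf_assms = u M \<delta> \<eta>(2,3)
  have v_meas [measurable]: "v j \<in> borel_measurable borel" for j
    unfolding v_def by (rule leaf_measurable[OF leaf_assms])
  have v_abs: "\<bar>v j x\<bar> \<le> M + 1" for j x
    unfolding v_def by (rule leaf_abs_le[OF leaf_assms])
  have shift: "0 \<le> T / real N * real j" "norm (x + (- (T / real N * real j)) *\<^sub>R e) \<le> R + T * norm e" if "norm x < R" "j \<le> N" for x j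
  proof -
    show "0 \<le> T / real N * real j" using T by simp
    have "T / real N * real j \<le> T" using T that N(2) by (simp add: divide_simps)
    from mult_right_mono[OF this norm_ge_zero[of e]]
    have "norm ((- (T / real N * real j)) *\<^sub>R e) \<le> T * norm e"
      using T by (simp add: abs_mult)
    then show "norm (x + (- (T / real N * real j)) *\<^sub>R e) \<le> R + T * norm e"
      using norm_triangle_ineq[of x "(- (T / real N * real j)) *\<^sub>R e"] that(1) by linarith
  qed
  have v_le: "v j x \<le> u (x + (- (T / real N * real j)) *\<^sub>R e)" if "j \<le> N" for j x
    using g_le[OF shift(2)[OF _ that], of x] M[of "x + (- (T / real N * real j)) *\<^sub>R e"] 
    by (auto simp: v_def leaf_def)
  have v_le_u: "v j x \<le> u x" if "j \<le> N" for j x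
    using v_le[OF that, of x] mono[of "- (T / real N * real j)" 0 x] T by simp
  have v_anti: "v (Suc j) x \<le> v j x" for j x
  proof -
    have "T / real N * real j \<le> T / real N * real (Suc j)" using T by (intro mult_left_mono) auto
    then show ?thesis unfolding v_def by (intro leaf_mono[OF u M \<delta> mono] le_imp_neg_le) auto
  qed
  have v_step: "v j x - v (Suc j) x \<le> r / 4" for j x
  proof -
    let ?a = "x + (- (T / real N * real j)) *\<^sub>R e" and ?b = "x + (- (T / real N * real (Suc j))) *\<^sub>R e"
    have "?a - ?b = (T / real N) *\<^sub>R e" by (simp add: algebra_simps add_divide_distrib)
    then have "norm (?a - ?b) \<le> \<theta>'" using N T by simp
    from \<theta>'(2)[OF this] have "?g ?a - ?g ?b \<le> r / 4" by linarith
    then show ?thesis using r(1) by (simp add: v_def leaf_def)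
  qed
  define C where "C = (\<bar>2 / \<delta>\<bar> + 4 * (M + 1)) / 2 * (\<integral>z. min 1 ((norm z)\<^sup>2) / norm (z::'a) powr p \<partial>lborel)"
  have v_C: "trunc_lap p \<epsilon> (v j) x \<le> C" if "\<epsilon> > 0" "x \<in> \<Omega>" for \<epsilon> j x
    unfolding v_def C_def using that inR by (intro trunc_lap_leaf_bounded[OF leaf_assms p])
  have v_sub: "\<forall>\<^sub>F \<epsilon> in at_right 0. c * trunc_lap p \<epsilon> (v j) x \<le> f (u (?y (x + (- (T / real N * real j)) *\<^sub>R e))) + \<kappa> / 2" if "x \<in> \<Omega>" for j x
  proof -
    let ?z = "?y (x + (- (T / real N * real j)) *\<^sub>R e)"
    have "\<forall>\<^sub>F \<epsilon> in at_right 0. c * trunc_lap p \<epsilon> u ?z < f (u ?z) + \<kappa> / 4"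
      using sol[of ?z] \<kappa> by (intro order_tendstoD) auto
    moreover have "\<forall>\<^sub>F \<epsilon> in at_right 0. (0::real) < \<epsilon>" by (rule eventually_at_right_less)
    ultimately show ?thesis
    proof eventually_elim
      case (elim \<epsilon>)
      have "trunc_lap p \<epsilon> (v j) x \<le> trunc_lap p \<epsilon> u ?z + 4 * M * (\<integral>z. trunc_kernel p \<rho> (z::'a) \<partial>lborel)"
        unfolding v_def using inR[OF that] \<rho> elim by (intro trunc_lap_leaf_le[OF leaf_assms p]) auto
      from mult_left_mono[OF this, of c] c
      have "c * trunc_lap p \<epsilon> (v j) x \<le> c * trunc_lap p \<epsilon> u ?z + c * (4 * M * (\<integral>z. trunc_kernel p \<rho> (z::'a) \<partial>lborel))"
        by (simp add: distrib_left)
      then show ?case using elim \<rho>(3) by linarith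
    qed
  qed
  have v_contact: "\<bar>v j x - u (?y (x + (- (T / real N * real j)) *\<^sub>R e))\<bar> \<le> r / 2" if "x \<in> \<Omega>" "j \<le> N" for j x
    using inR(3)[OF that(1)] g_ge[OF shift(2)[OF _ that(2)], of x] sup_conv_le_contact[OF u M \<delta>, of "x + (- (T / real N * real j)) *\<^sub>R e"] \<eta>
    by (simp add: v_def leaf_def)
  have mvt: "\<exists>\<xi>. a \<le> \<xi> \<and> \<xi> \<le> b \<and> F b - F a = (b - a) * f \<xi>" if "a < b" for a b
    using MVT2[OF that, of F f] F by (metis less_imp_le)
  show ?thesis
  proof (rule that[of "v 0"])
    show "v 0 \<in> borel_measurable borel" by simp
    show "\<bar>v 0 x\<bar> \<le> M + 1" for x by (rule v_abs)
    show "v 0 x \<le> u x" for x by (rule v_le_u) simp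
    show "u x - \<kappa> \<le> v 0 x" if "norm x \<le> 1 / \<kappa>" for x
    proof -
      have "norm x < R" using that \<rho> R0(1) by (simp add: R_def)
      then show ?thesis using sup_conv_ge_self[OF u M \<delta>, of x] \<eta> by (simp add: v_def leaf_def)
    qed
  next
    fix w :: "'a \<Rightarrow> real"
    assume w_meas [measurable]: "w \<in> borel_measurable borel" and w_abs: "\<And>x. \<bar>w x\<bar> \<le> M"
      and w_off: "\<And>x. x \<notin> \<Omega> \<Longrightarrow> w x = u x" and fin: "dirichlet p 0 \<Omega> w < \<infinity>"
    define W where "W = (\<lambda>j x. max (w x) (v j x))"
    have W_meas [measurable]: "W j \<in> borel_measurable borel" for j unfolding W_def by measurable
    have w_abs': "\<bar>w x\<bar> \<le> M + 1" for x using w_abs[of x] by simp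
    have W_abs: "\<bar>W j x\<bar> \<le> M + 1" for j x
      using w_abs'[of x] v_abs[of j x] unfolding W_def by (simp add: max_def)
    have W_int: "set_integrable lborel \<Omega> (W j)" for j
      using W_abs by (intro bounded_set_integrable[OF \<Omega> bd]) auto
    have w_int: "set_integrable lborel \<Omega> w"
      using w_abs by (intro bounded_set_integrable[OF \<Omega> bd]) auto
    \<comment> \<open>From w to its maximum with the lowest leaf. All values of f are at most A in absolute value, so
      replacing f at one point by f at another costs at most 2A.\<close>
    have last: "dirichlet p 0 \<Omega> (W N) < \<infinity> \<and>
       finite_energy c p F \<Omega> (W N) \<le> finite_energy c p F \<Omega> w + (2 * A + \<kappa>) * (LINT x:\<Omega>|lborel. W N x - w x)"
      unfolding W_def
    proof (intro conjI energy_max_subsolution_le[OF p c \<Omega> bd contF w_meas v_meas w_abs' v_abs _ v_C _ fin])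
      show "v N x \<le> w x" if "x \<notin> \<Omega>" for x using v_le_u[of N x] w_off[OF that] by simp
      then show "v N x \<le> w x" if "x \<notin> \<Omega>" for x using that .
      show "\<forall>\<^sub>F \<epsilon> in at_right 0. (v N x - w x) * (c * trunc_lap p \<epsilon> (v N) x) \<le> F (v N x) - F (w x) + (2 * A + \<kappa>) * (v N x - w x)"
        if x: "x \<in> \<Omega>" "w x < v N x" for x
        using v_sub[OF x(1), of N]
      proof eventually_elim
        case (elim \<epsilon>)
        obtain \<xi> where \<xi>: "w x \<le> \<xi>" "\<xi> \<le> v N x" "F (v N x) - F (w x) = (v N x - w x) * f \<xi>"
          using mvt[OF x(2)] by blast
        have "\<bar>\<xi>\<bar> \<le> M + 1" using \<xi> w_abs'[of x] v_abs[of N x] by linarith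
        then have "- A \<le> f \<xi>" using A[of \<xi>] by linarith
        moreover have "f (u (?y (x + (- (T / real N * real N)) *\<^sub>R e))) \<le> A"
          using A[of "u (?y (x + (- (T / real N * real N)) *\<^sub>R e))"] M[of "?y (x + (- (T / real N * real N)) *\<^sub>R e)"] by linarith
        ultimately have "c * trunc_lap p \<epsilon> (v N) x \<le> f \<xi> + (2 * A + \<kappa>)"
          using elim \<kappa> by linarith
        then have "(v N x - w x) * (c * trunc_lap p \<epsilon> (v N) x) \<le> (v N x - w x) * (f \<xi> + (2 * A + \<kappa>))"
          using x by (intro mult_left_mono) auto
        then show ?case using \<xi>(3) by (simp add: algebra_simps)
      qed
      then show "\<forall>\<^sub>F \<epsilon> in at_right 0. (v N x - w x) * (c * trunc_lap p \<epsilon> (v N) x) \<le> F (v N x) - F (w x) + (2 * A + \<kappa>) * (v N x - w x)"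
        if x: "x \<in> \<Omega>" "w x < v N x" for x using that .
    qed auto
    have step: "dirichlet p 0 \<Omega> (W j) < \<infinity> \<and>
       finite_energy c p F \<Omega> (W j) \<le> finite_energy c p F \<Omega> (W (Suc j)) + \<kappa> * (LINT x:\<Omega>|lborel. W j x - W (Suc j) x)"
      if j: "Suc j \<le> N" and fin': "dirichlet p 0 \<Omega> (W (Suc j)) < \<infinity>" for j
    proof -
      have W_eq: "W j = (\<lambda>x. max (W (Suc j) x) (v j x))"
        using v_anti[of j] by (auto simp: W_def fun_eq_iff max_def) (smt (verit))+
      have off: "v j x \<le> W (Suc j) x" if "x \<notin> \<Omega>" for x
        using v_le_u[of j x] j w_off[OF that] by (simp add: W_def)
      have sub: "\<forall>\<^sub>F \<epsilon> in at_right 0. (v j x - W (Suc j) x) * (c * trunc_lap p \<epsilon> (v j) x) \<le> F (v j x) - F (W (Suc j) x) + \<kappa> * (v j x - W (Suc j) x)"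
        if x: "x \<in> \<Omega>" "W (Suc j) x < v j x" for x
        using v_sub[OF x(1), of j]
      proof eventually_elim
        case (elim \<epsilon>)
        let ?z = "u (?y (x + (- (T / real N * real j)) *\<^sub>R e))"
        obtain \<xi> where \<xi>: "W (Suc j) x \<le> \<xi>" "\<xi> \<le> v j x" "F (v j x) - F (W (Suc j) x) = (v j x - W (Suc j) x) * f \<xi>"
          using mvt[OF x(2)] by blast
        have "v (Suc j) x \<le> \<xi>" using \<xi>(1) by (simp add: W_def)
        then have "\<bar>?z - \<xi>\<bar> \<le> r" 
          using \<xi>(2) v_step[of j x] v_contact[OF x(1) Suc_leD[OF j]] r(1) by linarith
        moreover have "\<bar>\<xi>\<bar> \<le> M + 1" using \<xi> W_abs[of "Suc j" x] v_abs[of j x] by linarith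
        moreover have "\<bar>?z\<bar> \<le> M + 1" using M[of "?y (x + (- (T / real N * real j)) *\<^sub>R e)"] by linarith
        ultimately have "f ?z \<le> f \<xi> + \<kappa> / 2" by (intro r(2))
        then have "c * trunc_lap p \<epsilon> (v j) x \<le> f \<xi> + \<kappa>" using elim by linarith
        then have "(v j x - W (Suc j) x) * (c * trunc_lap p \<epsilon> (v j) x) \<le> (v j x - W (Suc j) x) * (f \<xi> + \<kappa>)"
          using x by (intro mult_left_mono) auto
        then show ?case using \<xi>(3) by (simp add: algebra_simps)
      qed
      show ?thesis
        unfolding W_eq
        using energy_max_subsolution_le[OF p c \<Omega> bd contF W_meas v_meas W_abs v_abs off v_C sub fin'] by blast
    qed
    have chain: "dirichlet p 0 \<Omega> (W (N - i)) < \<infinity> \<and>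
       finite_energy c p F \<Omega> (W (N - i)) \<le> finite_energy c p F \<Omega> (W N) + \<kappa> * (LINT x:\<Omega>|lborel. W (N - i) x - W N x)"
      if "i \<le> N" for i
      using that
    proof (induction i)
      case 0
      then show ?case using last by (simp add: set_lebesgue_integral_def)
    next
      case (Suc i)
      then have IH: "dirichlet p 0 \<Omega> (W (N - i)) < \<infinity>"
        "finite_energy c p F \<Omega> (W (N - i)) \<le> finite_energy c p F \<Omega> (W N) + \<kappa> * (LINT x:\<Omega>|lborel. W (N - i) x - W N x)" by auto
      have s: "Suc (N - Suc i) = N - i" using Suc.prems by simp
      note st = step[of "N - Suc i", unfolded s, OF _ IH(1)]
      have "(LINT x:\<Omega>|lborel. W (N - Suc i) x - W (N - i) x) + (LINT x:\<Omega>|lborel. W (N - i) x - W N x) = (LINT x:\<Omega>|lborel. W (N - Suc i) x - W N x)"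
        using W_int by (simp add: set_integral_diff)
      then have "\<kappa> * (LINT x:\<Omega>|lborel. W (N - Suc i) x - W (N - i) x) + \<kappa> * (LINT x:\<Omega>|lborel. W (N - i) x - W N x) = \<kappa> * (LINT x:\<Omega>|lborel. W (N - Suc i) x - W N x)"
        by (metis distrib_left)
      then show ?case using st IH(2) by auto
    qed
    have "\<bar>W 0 x - W N x\<bar> \<le> 2 * M + 2" for x
      using W_abs[of 0 x] W_abs[of N x] by linarith
    then have i1: "(LINT x:\<Omega>|lborel. W 0 x - W N x) \<le> (2 * M + 2) * measure lborel \<Omega>"
      by (intro set_integral_abs_le[OF \<Omega> bd]) auto
    have i2: "(LINT x:\<Omega>|lborel. W N x - w x) \<le> (LINT x:\<Omega>|lborel. max 0 (u (x - T *\<^sub>R e) - w x))"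
    proof (rule set_integral_mono)
      show "set_integrable lborel \<Omega> (\<lambda>x. W N x - w x)"
        using W_int w_int by (rule set_integral_diff)
      have [measurable]: "u \<in> borel_measurable borel" using u by (rule borel_measurable_continuous_onI)
      have "\<bar>max 0 (u (x - T *\<^sub>R e) - w x)\<bar> \<le> 2 * M" for x
        using M[of "x - T *\<^sub>R e"] w_abs[of x] by (simp add: max_def abs_le_iff)
      then show "set_integrable lborel \<Omega> (\<lambda>x. max 0 (u (x - T *\<^sub>R e) - w x))"
        by (intro bounded_set_integrable[OF \<Omega> bd, where B = "2 * M"]) simp_all
      show "W N x - w x \<le> max 0 (u (x - T *\<^sub>R e) - w x)" for x
        using v_le[of N x] N(2) by (simp add: W_def max_def)
    qed
    have "\<kappa> * (LINT x:\<Omega>|lborel. W 0 x - W N x) \<le> \<kappa> * ((2 * M + 2) * measure lborel \<Omega>)"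
      using i1 \<kappa> by (intro mult_left_mono) auto
    moreover have "(2 * A + \<kappa>) * (LINT x:\<Omega>|lborel. W N x - w x) \<le> (2 * A + \<kappa>) * (LINT x:\<Omega>|lborel. max 0 (u (x - T *\<^sub>R e) - w x))"
      using i2 \<kappa> A0 by (intro mult_left_mono) auto
    ultimately show "dirichlet p 0 \<Omega> (\<lambda>x. max (w x) (v 0 x)) < \<infinity> \<and>
        finite_energy c p F \<Omega> (\<lambda>x. max (w x) (v 0 x)) \<le> finite_energy c p F \<Omega> w
          + \<kappa> * ((2 * M + 2) * measure lborel \<Omega>)
          + (2 * A + \<kappa>) * (LINT x:\<Omega>|lborel. max 0 (u (x - T *\<^sub>R e) - w x))"
      using chain[of N] last by (auto simp: W_def)
  qed
qed

section \<open>Comparison with the solution\<close>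

text \<open>
  Let $T = 1/\kappa$ run through the positive integers: the top leaves converge to $u$ pointwise, the total cost tends to $0$ because $w$ lies above the limits of $u$ along $-e$, and the
  Dirichlet part is lower semicontinuous.
\<close>
lemma max_solution_energy_le:
  fixes u w :: "'a::euclidean_space \<Rightarrow> real"
  assumes p: "real DIM('a) < p" "p < real DIM('a) + 2" and c: "c > 0"
    and \<Omega> [measurable]: "\<Omega> \<in> sets borel" and bd: "bounded \<Omega>"
    and F: "\<And>r. (F has_real_derivative f r) (at r)" and f: "continuous_on UNIV f"
    and u: "continuous_on UNIV u" and M: "\<And>x. \<bar>u x\<bar> \<le> M"
    and sol: "\<And>x. ((\<lambda>\<epsilon>. c * trunc_lap p \<epsilon> u x) \<longlongrightarrow> f (u x)) (at_right 0)"
    and mono: "\<And>x s t. s \<le> t \<Longrightarrow> u (x + s *\<^sub>R e) \<le> u (x + t *\<^sub>R e)"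
    and w_meas [measurable]: "w \<in> borel_measurable borel" and w_abs: "\<And>x. \<bar>w x\<bar> \<le> M"
    and w_off: "\<And>x. x \<notin> \<Omega> \<Longrightarrow> w x = u x"
    and below: "\<And>x. (\<lambda>n. max 0 (u (x - real n *\<^sub>R e) - w x)) \<longlonglongrightarrow> 0"
    and fin: "dirichlet p 0 \<Omega> w < \<infinity>"
  shows "dirichlet p 0 \<Omega> (\<lambda>x. max (w x) (u x)) < \<infinity>"
    and "finite_energy c p F \<Omega> (\<lambda>x. max (w x) (u x)) \<le> finite_energy c p F \<Omega> w"
proof -
  have [measurable]: "u \<in> borel_measurable borel" using u by (rule borel_measurable_continuous_onI)
  have M0: "M \<ge> 0" using M[of 0] by linarith
  have contF: "continuous_on UNIV F"
    using F by (intro continuous_at_imp_continuous_on) (auto intro: DERIV_isCont)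
  have [measurable]: "F \<in> borel_measurable borel" using contF by (rule borel_measurable_continuous_onI)
  obtain A where A: "A \<ge> 0" "\<And>r. \<bar>r\<bar> \<le> M + 1 \<Longrightarrow> \<bar>f r\<bar> \<le> A"
    using continuous_bounded_on_bounded_range[OF f] by metis
  obtain Q where Q: "Q \<ge> 0" "\<And>r. \<bar>r\<bar> \<le> M + 1 \<Longrightarrow> \<bar>F r\<bar> \<le> Q"
    using continuous_bounded_on_bounded_range[OF contF] by metis
  define \<kappa> where "\<kappa> = (\<lambda>n. 1 / real (Suc n))"
  have \<kappa>: "\<kappa> n > 0" "\<kappa> n \<le> 1" for n by (auto simp: \<kappa>_def)
  have \<kappa>_lim: "\<kappa> \<longlonglongrightarrow> 0" unfolding \<kappa>_def using LIMSEQ_inverse_real_of_nat by (simp add: inverse_eq_divide)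
  define g where "g = (\<lambda>n. LINT x:\<Omega>|lborel. max 0 (u (x - real (Suc n) *\<^sub>R e) - w x))"
  define err where "err = (\<lambda>n. \<kappa> n * ((2 * M + 2) * measure lborel \<Omega>) + (2 * A + \<kappa> n) * g n)"
  have ex: "\<forall>n. \<exists>v. v \<in> borel_measurable borel \<and> (\<forall>x. \<bar>v x\<bar> \<le> M + 1) \<and> (\<forall>x. v x \<le> u x) \<and>
      (\<forall>x. norm x \<le> 1 / \<kappa> n \<longrightarrow> u x - \<kappa> n \<le> v x) \<and>
      dirichlet p 0 \<Omega> (\<lambda>x. max (w x) (v x)) < \<infinity> \<and>
      finite_energy c p F \<Omega> (\<lambda>x. max (w x) (v x)) \<le> finite_energy c p F \<Omega> w + err n"
  proof
    fix n
    obtain v where v: "v \<in> borel_measurable borel" "\<And>x. \<bar>v x\<bar> \<le> M + 1" "\<And>x. v x \<le> u x"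
      "\<And>x. norm x \<le> 1 / \<kappa> n \<Longrightarrow> u x - \<kappa> n \<le> v x"
      "\<And>w. \<lbrakk>w \<in> borel_measurable borel; \<And>x. \<bar>w x\<bar> \<le> M; \<And>x. x \<notin> \<Omega> \<Longrightarrow> w x = u x; dirichlet p 0 \<Omega> w < \<infinity>\<rbrakk>
      \<Longrightarrow> dirichlet p 0 \<Omega> (\<lambda>x. max (w x) (v x)) < \<infinity> \<and>
        finite_energy c p F \<Omega> (\<lambda>x. max (w x) (v x)) \<le> finite_energy c p F \<Omega> w
          + \<kappa> n * ((2 * M + 2) * measure lborel \<Omega>)
          + (2 * A + \<kappa> n) * (LINT x:\<Omega>|lborel. max 0 (u (x - real (Suc n) *\<^sub>R e) - w x))"
      by (rule near_max_energy_le[OF p c \<Omega> bd F f A(2) u M sol mono _ \<kappa>, where T = "real (Suc n)"]) auto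
    from v(5)[OF w_meas w_abs w_off fin] v(1-4) show "\<exists>v. v \<in> borel_measurable borel \<and> (\<forall>x. \<bar>v x\<bar> \<le> M + 1) \<and> (\<forall>x. v x \<le> u x) \<and>
      (\<forall>x. norm x \<le> 1 / \<kappa> n \<longrightarrow> u x - \<kappa> n \<le> v x) \<and>
      dirichlet p 0 \<Omega> (\<lambda>x. max (w x) (v x)) < \<infinity> \<and>
      finite_energy c p F \<Omega> (\<lambda>x. max (w x) (v x)) \<le> finite_energy c p F \<Omega> w + err n"
      by (intro exI[of _ v]) (auto simp: err_def g_def)
  qed
  from choice[OF ex] obtain v where v_meas [measurable]: "\<And>n. v n \<in> borel_measurable borel"
    and v_abs: "\<And>n x. \<bar>v n x\<bar> \<le> M + 1" and v_le: "\<And>n x. v n x \<le> u x"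
    and v_ge: "\<And>n x. norm x \<le> 1 / \<kappa> n \<Longrightarrow> u x - \<kappa> n \<le> v n x"
    and v_fin: "\<And>n. dirichlet p 0 \<Omega> (\<lambda>x. max (w x) (v n x)) < \<infinity>"
    and v_en: "\<And>n. finite_energy c p F \<Omega> (\<lambda>x. max (w x) (v n x)) \<le> finite_energy c p F \<Omega> w + err n"
    by blast
  define W where "W = (\<lambda>n x. max (w x) (v n x))"
  define U where "U = (\<lambda>x. max (w x) (u x))"
  have [measurable]: "W n \<in> borel_measurable borel" for n unfolding W_def by measurable
  have [measurable]: "U \<in> borel_measurable borel" unfolding U_def by measurable
  have W_abs: "\<bar>W n x\<bar> \<le> M + 1" for n x
  proof -
    have "W n x = w x \<or> W n x = v n x" by (simp add: W_def max_def)
    then show ?thesis using v_abs[of n x] w_abs[of x] by (elim disjE) linarith+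
  qed
  have v_lim: "(\<lambda>n. v n x) \<longlonglongrightarrow> u x" for x
  proof (rule tendsto_sandwich[of "\<lambda>n. u x - \<kappa> n" _ _ "\<lambda>n. u x"])
    show "\<forall>\<^sub>F n in sequentially. u x - \<kappa> n \<le> v n x"
      using eventually_ge_at_top[of "nat \<lceil>norm x\<rceil>"]
    proof eventually_elim
      case (elim n)
      then have "norm x \<le> real n" by (simp add: nat_le_iff ceiling_le_iff)
      then show ?case by (intro v_ge) (simp add: \<kappa>_def)
    qed
    show "(\<lambda>n. u x - \<kappa> n) \<longlonglongrightarrow> u x" using tendsto_diff[OF tendsto_const \<kappa>_lim, of "u x"] by simp
  qed (auto simp: v_le)
  have W_lim: "(\<lambda>n. W n x) \<longlonglongrightarrow> U x" for x
    unfolding W_def U_def by (intro tendsto_max tendsto_const v_lim)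
  have const_int: "integrable lborel (\<lambda>x. B * indicator \<Omega> x)" for B :: real
    using emeasure_bounded_finite[OF bd] by simp
  have F_lim: "(\<lambda>n. LINT x:\<Omega>|lborel. F (W n x)) \<longlonglongrightarrow> (LINT x:\<Omega>|lborel. F (U x))"
    unfolding set_lebesgue_integral_def
  proof (rule integral_dominated_convergence[OF _ _ const_int[of Q]])
    show "AE x in lborel. (\<lambda>n. indicator \<Omega> x *\<^sub>R F (W n x)) \<longlonglongrightarrow> indicator \<Omega> x *\<^sub>R F (U x)"
      by (intro AE_I2 tendsto_scaleR tendsto_const continuous_on_tendsto_compose[OF contF W_lim]) auto
    show "AE x in lborel. norm (indicator \<Omega> x *\<^sub>R F (W n x)) \<le> Q * indicator \<Omega> x" for n
      using Q(2)[OF W_abs] by (intro AE_I2) (auto simp: indicator_def)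
  qed measurable
  have "g \<longlonglongrightarrow> (\<integral>x. 0 \<partial>(lborel :: 'a measure))"
    unfolding g_def set_lebesgue_integral_def
  proof (rule integral_dominated_convergence[OF _ _ const_int[of "2 * M"]])
    show "AE x in lborel. (\<lambda>n. indicator \<Omega> x *\<^sub>R max 0 (u (x - real (Suc n) *\<^sub>R e) - w x)) \<longlonglongrightarrow> 0"
    proof (rule AE_I2)
      fix x
      show "(\<lambda>n. indicator \<Omega> x *\<^sub>R max 0 (u (x - real (Suc n) *\<^sub>R e) - w x)) \<longlonglongrightarrow> 0"
        using tendsto_scaleR[OF tendsto_const[of "indicator \<Omega> x :: real"] LIMSEQ_Suc[OF below[of x]]]
        by (simp only: scaleR_zero_right)
    qed
    have "\<bar>max 0 (u (x - real (Suc n) *\<^sub>R e) - w x)\<bar> \<le> 2 * M" for n x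
      using M[of "x - real (Suc n) *\<^sub>R e"] w_abs[of x] M0 by (auto simp: max_def)
    then show "AE x in lborel. norm (indicator \<Omega> x *\<^sub>R max 0 (u (x - real (Suc n) *\<^sub>R e) - w x)) \<le> 2 * M * indicator \<Omega> x" for n
      by (intro AE_I2) (auto simp: indicator_def)
  qed measurable
  then have g_lim: "g \<longlonglongrightarrow> 0" by simp
  have "err \<longlonglongrightarrow> 0 * ((2 * M + 2) * measure lborel \<Omega>) + (2 * A + 0) * 0"
    unfolding err_def by (intro tendsto_intros \<kappa>_lim g_lim)
  then have err_lim: "err \<longlonglongrightarrow> 0" by simp
  define d where "d = (\<lambda>n. 4 / c * (finite_energy c p F \<Omega> w + err n + (LINT x:\<Omega>|lborel. F (W n x))))"
  define D where "D = 4 / c * (finite_energy c p F \<Omega> w + (LINT x:\<Omega>|lborel. F (U x)))"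
  have "d \<longlonglongrightarrow> 4 / c * (finite_energy c p F \<Omega> w + 0 + (LINT x:\<Omega>|lborel. F (U x)))"
    unfolding d_def by (intro tendsto_intros err_lim F_lim)
  then have d_lim: "d \<longlonglongrightarrow> D" by (simp add: D_def)
  have real_le: "enn2real (dirichlet p 0 \<Omega> (W n)) \<le> d n" for n
  proof -
    have "c / 4 * enn2real (dirichlet p 0 \<Omega> (W n)) \<le> finite_energy c p F \<Omega> w + err n + (LINT x:\<Omega>|lborel. F (W n x))"
      using v_en[of n] unfolding finite_energy_def W_def by linarith
    from mult_left_mono[OF this, of "4 / c"] c show ?thesis by (simp add: d_def)
  qed
  have D0: "D \<ge> 0"
    using d_lim order_trans[OF enn2real_nonneg real_le] by (intro LIMSEQ_le_const) auto
  have "dirichlet p 0 \<Omega> U \<le> liminf (\<lambda>n. dirichlet p 0 \<Omega> (W n))"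
    by (rule dirichlet_le_liminf) (auto intro: W_lim)
  also have "\<dots> \<le> liminf (\<lambda>n. ennreal (d n))"
  proof (intro Liminf_mono always_eventually allI)
    fix n
    have "dirichlet p 0 \<Omega> (W n) = ennreal (enn2real (dirichlet p 0 \<Omega> (W n)))"
      using v_fin[of n] unfolding W_def by simp
    then show "dirichlet p 0 \<Omega> (W n) \<le> ennreal (d n)"
      using ennreal_leI[OF real_le] by (rule ord_eq_le_trans)
  qed
  also have "\<dots> = ennreal D"
    using tendsto_ennrealI[OF d_lim] by (intro lim_imp_Liminf) auto
  finally have le: "dirichlet p 0 \<Omega> U \<le> ennreal D" .
  then show "dirichlet p 0 \<Omega> (\<lambda>x. max (w x) (u x)) < \<infinity>"
    unfolding U_def by (simp add: le_less_trans[OF _ ennreal_less_top])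
  have "enn2real (dirichlet p 0 \<Omega> U) \<le> D" using le D0 by (simp add: enn2real_leI)
  from mult_left_mono[OF this, of "c / 4"] c
  have "c / 4 * enn2real (dirichlet p 0 \<Omega> U) \<le> finite_energy c p F \<Omega> w + (LINT x:\<Omega>|lborel. F (U x))"
    by (simp add: D_def)
  then show "finite_energy c p F \<Omega> (\<lambda>x. max (w x) (u x)) \<le> finite_energy c p F \<Omega> w"
    unfolding finite_energy_def[of c p F \<Omega> "\<lambda>x. max (w x) (u x)"] by (simp add: U_def)
qed

lemma trunc_lap_uminus: "trunc_lap p \<epsilon> (\<lambda>x. - u x) x = - trunc_lap p \<epsilon> u x"
proof -
  have "trunc_lap p \<epsilon> (\<lambda>x. - u x) x = (\<integral>y. - ((u x - u y) * trunc_kernel p \<epsilon> (x - y)) \<partial>lborel)"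
    unfolding trunc_lap_def by (intro Bochner_Integration.integral_cong) (auto simp: algebra_simps)
  then show ?thesis by (simp add: trunc_lap_def)
qed

lemma dirichlet_uminus: "dirichlet p \<epsilon> \<Omega> (\<lambda>x. - u x) = dirichlet p \<epsilon> \<Omega> u"
proof -
  have "\<bar>- a - - b\<bar> = \<bar>a - b\<bar>" for a b :: real by linarith
  then show ?thesis unfolding dirichlet_def by simp
qed

lemma finite_energy_uminus: "finite_energy c p (\<lambda>r. F (- r)) \<Omega> (\<lambda>x. - u x) = finite_energy c p F \<Omega> u"
  unfolding finite_energy_def by (simp add: dirichlet_uminus)

text \<open>
  The reflection $u \mapsto -u$, $w \mapsto -w$, $F(r) \mapsto F(-r)$ preserves the equation and the
  energy; replacing $e$ by $-e$ restores monotonicity.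
\<close>
lemma min_solution_energy_le:
  fixes u w :: "'a::euclidean_space \<Rightarrow> real"
  assumes p: "real DIM('a) < p" "p < real DIM('a) + 2" and c: "c > 0"
    and \<Omega>: "\<Omega> \<in> sets borel" and bd: "bounded \<Omega>"
    and F: "\<And>r. (F has_real_derivative f r) (at r)" and f: "continuous_on UNIV f"
    and u: "continuous_on UNIV u" and M: "\<And>x. \<bar>u x\<bar> \<le> M"
    and sol: "\<And>x. ((\<lambda>\<epsilon>. c * trunc_lap p \<epsilon> u x) \<longlongrightarrow> f (u x)) (at_right 0)"
    and mono: "\<And>x s t. s \<le> t \<Longrightarrow> u (x + s *\<^sub>R e) \<le> u (x + t *\<^sub>R e)"
    and w_meas [measurable]: "w \<in> borel_measurable borel" and w_abs: "\<And>x. \<bar>w x\<bar> \<le> M"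
    and w_off: "\<And>x. x \<notin> \<Omega> \<Longrightarrow> w x = u x"
    and above: "\<And>x. (\<lambda>n. max 0 (w x - u (x + real n *\<^sub>R e))) \<longlonglongrightarrow> 0"
    and fin: "dirichlet p 0 \<Omega> w < \<infinity>"
  shows "dirichlet p 0 \<Omega> (\<lambda>x. min (w x) (u x)) < \<infinity>"
    and "finite_energy c p F \<Omega> (\<lambda>x. min (w x) (u x)) \<le> finite_energy c p F \<Omega> w"
proof -
  have eq: "(\<lambda>x. max (- w x) (- u x)) = (\<lambda>x. - min (w x) (u x))" by (auto simp: fun_eq_iff)
  have F': "((\<lambda>r. F (- r)) has_real_derivative (- f (- r))) (at r)" for r
    using DERIV_chain2[OF F DERIV_minus[OF DERIV_ident], of r] by simp
  have f': "continuous_on UNIV (\<lambda>r. - f (- r))"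
    by (intro continuous_intros continuous_on_compose2[OF f]) auto
  have sol': "((\<lambda>\<epsilon>. c * trunc_lap p \<epsilon> (\<lambda>x. - u x) x) \<longlongrightarrow> - f (- (- u x))) (at_right 0)" for x
    using tendsto_minus[OF sol[of x]] by (simp add: trunc_lap_uminus)
  have mono': "- u (x + s *\<^sub>R (- e)) \<le> - u (x + t *\<^sub>R (- e))" if "s \<le> t" for x s t
    using mono[of "- t" "- s" x] that by simp
  note le = max_solution_energy_le[OF p c \<Omega> bd F' f', of "\<lambda>x. - u x" M "- e" "\<lambda>x. - w x", OF _ _ sol' mono']
  have "dirichlet p 0 \<Omega> (\<lambda>x. max (- w x) (- u x)) < \<infinity> \<and>
     finite_energy c p (\<lambda>r. F (- r)) \<Omega> (\<lambda>x. max (- w x) (- u x)) \<le> finite_energy c p (\<lambda>r. F (- r)) \<Omega> (\<lambda>x. - w x)"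
    using u M w_abs w_off above fin
    by (intro conjI le) (auto intro!: continuous_intros simp: dirichlet_uminus)
  then show "dirichlet p 0 \<Omega> (\<lambda>x. min (w x) (u x)) < \<infinity>"
    and "finite_energy c p F \<Omega> (\<lambda>x. min (w x) (u x)) \<le> finite_energy c p F \<Omega> w"
    unfolding eq finite_energy_uminus[where F = F] dirichlet_uminus by blast+
qed

section \<open>Minimality\<close>

lemma set_coord_eq: "set_coord k x \<tau> = x + (\<tau> - x $ k) *\<^sub>R axis k 1"
  by (simp add: set_coord_def vec_eq_iff axis_def)

lemma trunc_kernel_0: "trunc_kernel p 0 z = 1 / norm z powr p"
  by (simp add: trunc_kernel_def)

lemma has_frac_laplacian_trunc_lap:
  fixes u :: "real ^ 'n::finite \<Rightarrow> real"
  assumes "has_frac_laplacian c s u l x"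
  shows "((\<lambda>\<epsilon>. c * trunc_lap (real CARD('n) + 2 * s) \<epsilon> u x) \<longlongrightarrow> l) (at_right 0)"
proof -
  have "trunc_lap (real CARD('n) + 2 * s) \<epsilon> u x = (LINT y:{y. norm (x - y) > \<epsilon>}|lborel.
        (u x - u y) / norm (x - y) powr (real CARD('n) + 2 * s))" for \<epsilon>
    unfolding trunc_lap_def set_lebesgue_integral_def trunc_kernel_def
    by (intro Bochner_Integration.integral_cong) (auto simp: indicator_def)
  then show ?thesis using assms by (simp add: has_frac_laplacian_def)
qed

lemma energy_eq:
  fixes w :: "real ^ 'n::finite \<Rightarrow> real"
  shows "energy c s F \<Omega> w = ereal (c / 4) * enn2ereal (dirichlet (real CARD('n) + 2 * s) 0 \<Omega> w)
     - ereal (LINT x:\<Omega>|lborel. F (w x))"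
  unfolding energy_def dirichlet_def by (simp add: trunc_kernel_0)

lemma energy_finite:
  fixes w :: "real ^ 'n::finite \<Rightarrow> real"
  assumes "dirichlet (real CARD('n) + 2 * s) 0 \<Omega> w < \<infinity>"
  shows "energy c s F \<Omega> w = ereal (finite_energy c (real CARD('n) + 2 * s) F \<Omega> w)"
proof -
  obtain d where "d \<ge> 0" "dirichlet (real CARD('n) + 2 * s) 0 \<Omega> w = ennreal d"
    using assms by (cases "dirichlet (real CARD('n) + 2 * s) 0 \<Omega> w") auto
  then show ?thesis by (simp add: energy_eq finite_energy_def enn2ereal_ennreal)
qed

lemma energy_infinite:
  fixes w :: "real ^ 'n::finite \<Rightarrow> real"
  assumes "c > 0" "\<not> dirichlet (real CARD('n) + 2 * s) 0 \<Omega> w < \<infinity>"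
  shows "energy c s F \<Omega> w = \<infinity>"
proof -
  have "dirichlet (real CARD('n) + 2 * s) 0 \<Omega> w = top" using assms(2) by (simp add: less_top[symmetric])
  then show ?thesis using assms(1) by (simp add: energy_eq)
qed

lemma mono_bounded_tendsto:
  fixes \<phi> :: "real \<Rightarrow> real"
  assumes mono: "mono \<phi>" and M: "\<And>t. \<bar>\<phi> t\<bar> \<le> M"
  shows "(\<phi> \<longlongrightarrow> Inf (range \<phi>)) at_bot" and "(\<phi> \<longlongrightarrow> Sup (range \<phi>)) at_top"
    and "Inf (range \<phi>) \<le> \<phi> t" and "\<phi> t \<le> Sup (range \<phi>)"
    and "- M \<le> Inf (range \<phi>)" and "Sup (range \<phi>) \<le> M"
proof -
  have bb: "bdd_below (range \<phi>)" using M by (intro bdd_belowI[of _ "- M"]) (auto simp: abs_le_iff minus_le_iff)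
  have ba: "bdd_above (range \<phi>)" using M by (intro bdd_aboveI[of _ M]) (auto simp: abs_le_iff)
  show lo: "Inf (range \<phi>) \<le> \<phi> t" for t using bb by (intro cInf_lower) auto
  show up: "\<phi> t \<le> Sup (range \<phi>)" for t using ba by (intro cSup_upper) auto
  show "- M \<le> Inf (range \<phi>)" using M by (intro cInf_greatest) (auto simp: abs_le_iff minus_le_iff)
  show "Sup (range \<phi>) \<le> M" using M by (intro cSup_least) (auto simp: abs_le_iff)
  show "(\<phi> \<longlongrightarrow> Inf (range \<phi>)) at_bot"
  proof (rule decreasing_tendsto)
    fix y assume "Inf (range \<phi>) < y"
    then obtain t where "\<phi> t < y" using cInf_lessD[of "range \<phi>" y] by auto
    then show "\<forall>\<^sub>F t in at_bot. \<phi> t < y"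
      using mono by (auto simp: eventually_at_bot_linorder mono_def intro!: exI[of _ t] intro: le_less_trans)
  qed (simp add: lo)
  show "(\<phi> \<longlongrightarrow> Sup (range \<phi>)) at_top"
  proof (rule increasing_tendsto)
    fix y assume "y < Sup (range \<phi>)"
    then obtain t where "y < \<phi> t" using less_cSupD[of "range \<phi>" y] by auto
    then show "\<forall>\<^sub>F t in at_top. y < \<phi> t"
      using mono by (auto simp: eventually_at_top_linorder mono_def intro!: exI[of _ t] intro: less_le_trans)
  qed (simp add: up)
qed

theorem corollary1p4:
  fixes s c :: real and F :: "real \<Rightarrow> real"
    and u :: "real ^ 'n::finite \<Rightarrow> real" and k :: 'n and \<Omega> :: "(real ^ 'n) set"
  assumes "0 < s" and "s < 1"
    and "c > 0"
    and "C_class 3 F"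
    and "bounded (range u)"
    and "continuous_on UNIV u"
    and "\<forall>x. has_frac_laplacian c s u (deriv F (u x)) x"
    and "\<forall>x. strict_mono (\<lambda>\<tau>. u (set_coord k x \<tau>))"
    and "open \<Omega>" and "connected \<Omega>" and "bounded \<Omega>"
  shows "minimizer_on (admissible k u \<Omega>) (energy c s F \<Omega>) u"
proof -
  define p where "p = real CARD('n) + 2 * s"
  define e :: "real ^ 'n" where "e = axis k 1"
  have p: "real DIM(real ^ 'n) < p" "p < real DIM(real ^ 'n) + 2"
    using assms(1,2) by (simp_all add: p_def)
  have \<Omega>: "\<Omega> \<in> sets borel" using \<open>open \<Omega>\<close> by simp
  obtain M where M: "\<And>x. \<bar>u x\<bar> \<le> M"
    using \<open>bounded (range u)\<close> by (auto simp: bounded_iff)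
  have diff: "(deriv ^^ j) F field_differentiable at r" if "j < 3" for j r
    using \<open>C_class 3 F\<close> that by (simp add: C_class_def)
  have F: "(F has_real_derivative deriv F r) (at r)" for r
    using diff[of 0 r] by (simp add: DERIV_deriv_iff_field_differentiable)
  have f: "continuous_on UNIV (deriv F)"
    using diff[of 1] by (intro continuous_at_imp_continuous_on ballI field_differentiable_imp_continuous_at) simp
  have sol: "((\<lambda>\<epsilon>. c * trunc_lap p \<epsilon> u x) \<longlongrightarrow> deriv F (u x)) (at_right 0)" for x
    unfolding p_def using assms(7) by (intro has_frac_laplacian_trunc_lap) simp
  have line: "u (x + t *\<^sub>R e) = u (set_coord k x (x $ k + t))" for x t
    by (simp add: set_coord_eq e_def)
  have self: "set_coord k x (x $ k) = x" for x by (simp add: set_coord_eq)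
  have mono: "mono (\<lambda>\<tau>. u (set_coord k x \<tau>))" for x
    using assms(8) by (blast intro: strict_mono_mono)
  have mono_e: "u (x + a *\<^sub>R e) \<le> u (x + b *\<^sub>R e)" if "a \<le> b" for x a b
    unfolding line using monoD[OF mono] that by simp
  define lo where "lo x = Inf (range (\<lambda>\<tau>. u (set_coord k x \<tau>)))" for x
  define hi where "hi x = Sup (range (\<lambda>\<tau>. u (set_coord k x \<tau>)))" for x
  have lo: "((\<lambda>\<tau>. u (set_coord k x \<tau>)) \<longlongrightarrow> lo x) at_bot" "lo x \<le> u (set_coord k x t)" "- M \<le> lo x"
    and hi: "((\<lambda>\<tau>. u (set_coord k x \<tau>)) \<longlongrightarrow> hi x) at_top" "u (set_coord k x t) \<le> hi x" "hi x \<le> M" for x t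
    unfolding lo_def hi_def by (rule mono_bounded_tendsto[OF mono M])+
  have Lim: "Lim at_bot (\<lambda>\<tau>. u (set_coord k x \<tau>)) = lo x" "Lim at_top (\<lambda>\<tau>. u (set_coord k x \<tau>)) = hi x" for x
    using lo(1)[of x] hi(1)[of x] by (auto intro!: tendsto_Lim)
  have at_top: "filterlim (\<lambda>n. a + real n) at_top sequentially" for a
    by (intro filterlim_tendsto_add_at_top[OF tendsto_const] filterlim_real_sequentially)
  then have "filterlim (\<lambda>n. - (- x $ k + real n)) at_bot sequentially" for x :: "real ^ 'n"
    by (subst filterlim_uminus_at_top[symmetric])
  from filterlim_compose[OF lo(1) this]
  have to_lo: "(\<lambda>n. u (x - real n *\<^sub>R e)) \<longlonglongrightarrow> lo x" for x
    using line[of x "- t" for t] by simp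
  have to_hi: "(\<lambda>n. u (x + real n *\<^sub>R e)) \<longlonglongrightarrow> hi x" for x
    using filterlim_compose[OF hi(1) at_top] by (simp add: line)
  show ?thesis
    unfolding minimizer_on_def
  proof (intro conjI ballI)
    show "u \<in> admissible k u \<Omega>"
      using assms(6) lo(2)[of x "x $ k" for x] hi(2)[of x "x $ k" for x] by (simp add: admissible_def Lim self)
    fix w assume "w \<in> admissible k u \<Omega>"
    then have w_cont: "continuous_on UNIV w" and w: "\<And>x. lo x \<le> w x" "\<And>x. w x \<le> hi x"
      and w_off: "\<And>x. x \<notin> \<Omega> \<Longrightarrow> w x = u x" by (auto simp: admissible_def Lim)
    have u_meas [measurable]: "u \<in> borel_measurable borel" and w_meas [measurable]: "w \<in> borel_measurable borel"
      using assms(6) w_cont by (auto intro: borel_measurable_continuous_onI)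
    have w_abs: "\<bar>w x\<bar> \<le> M" for x
      using w[of x] lo(3)[of x] hi(3)[of x] by (simp add: abs_le_iff)
    show "energy c s F \<Omega> u \<le> energy c s F \<Omega> w"
    proof (cases "dirichlet p 0 \<Omega> w < \<infinity>")
      case False
      then have "energy c s F \<Omega> w = \<infinity>" unfolding p_def by (rule energy_infinite[OF \<open>c > 0\<close>])
      then show ?thesis by simp
    next
      case fin: True
      define m where "m = (\<lambda>x. max (w x) (u x))"
      have m_meas: "m \<in> borel_measurable borel" unfolding m_def by measurable
      have m_abs: "\<bar>m x\<bar> \<le> M" for x using w_abs[of x] M[of x] by (auto simp: m_def max_def)
      have m_off: "m x = u x" if "x \<notin> \<Omega>" for x using w_off[OF that] by (simp add: m_def)
      have m_hi: "m x \<le> hi x" for x using w(2)[of x] hi(2)[of x "x $ k"] by (simp add: m_def self)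
      have below: "(\<lambda>n. max 0 (u (x - real n *\<^sub>R e) - w x)) \<longlonglongrightarrow> 0" for x
        using tendsto_max[OF tendsto_const tendsto_diff[OF to_lo tendsto_const], of 0 x "w x"] w(1)[of x] by simp
      have above: "(\<lambda>n. max 0 (m x - u (x + real n *\<^sub>R e))) \<longlonglongrightarrow> 0" for x
        using tendsto_max[OF tendsto_const tendsto_diff[OF tendsto_const to_hi], of 0 "m x" x] m_hi[of x] by simp
      \<comment> \<open>Raise w to the maximum m of w and u, then lower m to its minimum with u, which is u.\<close>
      note up = max_solution_energy_le[OF p \<open>c > 0\<close> \<Omega> \<open>bounded \<Omega>\<close> F f assms(6) M sol mono_e w_meas w_abs w_off below fin, folded m_def]
      note down = min_solution_energy_le[OF p \<open>c > 0\<close> \<Omega> \<open>bounded \<Omega>\<close> F f assms(6) M sol mono_e m_meas m_abs m_off above up(1)]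
      have "(\<lambda>x. min (m x) (u x)) = u" by (auto simp: m_def fun_eq_iff)
      then have "dirichlet p 0 \<Omega> u < \<infinity>" "finite_energy c p F \<Omega> u \<le> finite_energy c p F \<Omega> w"
        using down up(2) by simp_all
      then show ?thesis using fin by (simp add: p_def energy_finite)
    qed
  qed
qed

end
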